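(* Let $n\ge 1$ be an integer and $\alpha=n+\frac{m}{2}$ with $m$ a real number. There exists a $2$-dimensional polyomino consisting of $n$ cells whose convex hull has area $\alpha$ if and only if $m\in\mathbb{N}_0$, $0\le m\le \left\lfloor\frac{n-1}{2}\right\rfloor\left\lfloor\frac{n}{2}\right\rfloor$, and $m\neq 1$ if $n+1$ is a prime.
   Context: A $2$-dimensional polyomino with $n$ cells is an edge-to-edge connected system of $n$ distinct unit squares of the integer grid in $\mathbb{R}^2$: any two of its squares are joined by a chain of squares of the system in which consecutive squares share a full edge. Its convex hull is the convex hull in $\mathbb{R}^2$ of the union of its (closed) squares. $\mathbb{N}_0$ denotes the non-negative integers. *)

theory Defs
  imports "HOL-Analysis.Analysis" "HOL-Computational_Algebra.Primes"
begin

text \<open>A cell of the integer grid is represented by its lower left corner.\<close>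

type_synonym cell = "int \<times> int"

definition unit_square :: "cell \<Rightarrow> (real \<times> real) set" where
  "unit_square c =
     cbox (of_int (fst c), of_int (snd c)) (of_int (fst c) + 1, of_int (snd c) + 1)"

text \<open>Two grid squares have a full edge in common (and are distinct) iff one arises from the
  other by a unit translation along one of the two axes.\<close>

definition edge_adjacent :: "cell \<Rightarrow> cell \<Rightarrow> bool" where
  "edge_adjacent c d \<longleftrightarrow>
     fst c = fst d \<and> \<bar>snd c - snd d\<bar> = 1 \<or> \<bar>fst c - fst d\<bar> = 1 \<and> snd c = snd d"

definition edge_connected :: "cell set \<Rightarrow> bool" where
  "edge_connected P \<longleftrightarrow>
     (\<forall>c\<in>P. \<forall>d\<in>P. (c, d) \<in> {(x, y). x \<in> P \<and> y \<in> P \<and> edge_adjacent x y}\<^sup>*)"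

definition polyomino :: "nat \<Rightarrow> cell set \<Rightarrow> bool" where
  "polyomino n P \<longleftrightarrow> finite P \<and> card P = n \<and> edge_connected P"

definition polyomino_hull :: "cell set \<Rightarrow> (real \<times> real) set" where
  "polyomino_hull P = convex hull (\<Union>c\<in>P. unit_square c)"

end

theory Submission
  imports Defs
begin

text \<open>Grow the polyomino cell by cell. A new cell is a unit translate of an old one, so each slice
  of the hull parallel to the translation grows by at most the height of a tent function that is
  \<open>1\<close> over the new cell and falls linearly to \<open>0\<close> at the ends of the bounding box. Hence, after
  \<open>x\<close> horizontal and \<open>y\<close> vertical additions, the area is at most \<open>1 + x + y + x y / 2\<close>, and
  \<open>x + y = n - 1\<close>.

  The excess \<open>m\<close> is an integer because twice the area of a lattice polygon is one (cut it along
  diagonals into triangles). If \<open>m = 1\<close>, there must be a \<open>2 \<times> 2\<close> block with exactly one cell missing,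
  since otherwise the polyomino is a rectangle. The hull covers half of the missing cell, which uses
  up the whole excess; so there is only one such cell, adding it produces a rectangle, and \<open>n + 1\<close> is
  composite.

  Conversely, with \<open>x + y = n - 1\<close> a hook with arms \<open>x\<close> and \<open>y\<close> has excess \<open>x y\<close>, and slight
  modifications of it decrease the excess down to the value for the next pair \<open>(x + 1, y - 1)\<close>;
  small excesses come from polyominoes with two rows.\<close>

section \<open>Areas of lattice polygons\<close>

text \<open>The tent over a base of length x + 1 has integral 1 + x / 2, so a vertical addition pays
  one for the cell and turns x y / 2 into x (y + 1) / 2. This is why the two directions are counted
  separately and why a product appears in the bound.

  For excess one the obstacle is that filling the missing cell might create a new notch next to the
  filled cell. The hull would then meet one more missing cell, at least in a triangle with legs 1
  and 1/2, and there is no area left for it.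

  For the constructions, passing from (x, y) to (x + 1, y - 1) lowers the product by x + 1 - y only,
  so for y \<ge> 2 one pair has to supply fewer than x consecutive values. Cutting off a corner
  triangle with legs 1 and v lowers the excess by v, but making room for the bent arm costs 2 at
  once; therefore x y and x y - 1 need shapes of their own. The pairs with y \<ge> 2 are needed only
  above n - 2, the product at y = 1.\<close>

definition cross :: "real \<times> real \<Rightarrow> real \<times> real \<Rightarrow> real" where
  "cross u v = fst u * snd v - snd u * fst v"

lemma linear_pair_of_vec: "linear (\<lambda>v :: real^2. (v $ 1, v $ 2))"
  by (intro linearI) auto

text \<open>The triangle formula \<open>content_triangle\<close> is applied in
  \<open>real^2\<close>; identifying the two measures by their values on boxes carries it over to
  \<open>real \<times> real\<close>.\<close>

lemma distr_lborel_pair_of_vec: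
  "(lborel :: (real \<times> real) measure) = distr lborel borel (\<lambda>v :: real^2. (v $ 1, v $ 2))"
proof (rule lborel_eqI)
  let ?f = "\<lambda>v :: real^2. (v $ 1, v $ 2)"
  have [measurable]: "?f \<in> borel_measurable borel"
    using linear_pair_of_vec linear_continuous_on borel_measurable_continuous_onI
      linear_conv_bounded_linear by blast
  fix l u :: "real \<times> real"
  assume le: "\<And>b. b \<in> Basis \<Longrightarrow> l \<bullet> b \<le> u \<bullet> b"
  obtain l1 l2 u1 u2 where lu: "l = (l1, l2)" "u = (u1, u2)" by (cases l, cases u)
  have le': "l1 \<le> u1" "l2 \<le> u2"
    using le[of "(1, 0)"] le[of "(0, 1)"] lu by (auto simp: Basis_prod_def)
  have "?f -` box l u = box (vector [l1, l2]) (vector [u1, u2])"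
    by (auto simp: lu mem_box_cart forall_2 mem_box Basis_prod_def)
  then have "emeasure (distr lborel borel ?f) (box l u) =
      emeasure lborel (box (vector [l1, l2] :: real^2) (vector [u1, u2]))"
    by (subst emeasure_distr) auto
  also have "\<dots> = (\<Prod>b\<in>Basis. (u - l) \<bullet> b)"
    using le' by (subst emeasure_lborel_box)
      (auto simp: lu Basis_vec_def UNIV_2 inner_axis axis_eq_axis Basis_prod_def inner_Basis)
  finally show "emeasure (distr lborel borel ?f) (box l u) = (\<Prod>b\<in>Basis. (u - l) \<bullet> b)" .
qed simp

lemma measure_triangle:
  fixes A B C :: "real \<times> real"
  shows "measure lebesgue (convex hull {A, B, C}) = \<bar>cross (B - A) (C - A)\<bar> / 2"
proof -
  let ?f = "\<lambda>v :: real^2. (v $ 1, v $ 2)"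
  let ?g = "\<lambda>p :: real \<times> real. vector [fst p, snd p] :: real^2"
  have fg: "?f (?g p) = p" for p by simp
  have m: "?f \<in> borel_measurable borel"
    using linear_pair_of_vec linear_continuous_on borel_measurable_continuous_onI
      linear_conv_bounded_linear by blast
  have inj: "inj ?f" by (auto simp: inj_def vec_eq_iff forall_2)
  have hull: "convex hull {A, B, C} = ?f ` (convex hull {?g A, ?g B, ?g C})"
    by (subst convex_hull_linear_image[OF linear_pair_of_vec]) (simp add: fg)
  have cl: "convex hull {A, B, C} \<in> sets borel"
    by (intro borel_compact finite_imp_compact_convex_hull) auto
  have "measure lebesgue (convex hull {A, B, C}) = measure lborel (convex hull {A, B, C})"
    using cl by (simp add: measure_completion)
  also have "\<dots> = measure lborel (?f -` (convex hull {A, B, C}))"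
    by (subst distr_lborel_pair_of_vec, subst measure_distr) (use m cl in auto)
  also have "?f -` (convex hull {A, B, C}) = convex hull {?g A, ?g B, ?g C}"
    unfolding hull by (rule inj_vimage_image_eq[OF inj])
  also have "measure lborel \<dots> = \<bar>cross (B - A) (C - A)\<bar> / 2"
    by (subst content_triangle) (simp add: cross_def algebra_simps abs_minus_commute)
  finally show ?thesis .
qed

lemma negligible_line:
  fixes p a :: "real \<times> real"
  assumes "p \<noteq> 0"
  shows "negligible {z. cross p (z - a) = 0}"
proof -
  have "{z. cross p (z - a) = 0} = {z. (- snd p, fst p) \<bullet> z = (- snd p, fst p) \<bullet> a}"
    by (cases a) (auto simp: cross_def algebra_simps)
  moreover have "(- snd p, fst p) \<noteq> 0" using assms by (auto simp: prod_eq_iff)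
  ultimately show ?thesis using negligible_hyperplane[of "(- snd p, fst p)"] by metis
qed

lemma cross_eq_0D:
  assumes "cross p q = 0" "p \<noteq> 0"
  obtains t where "q = t *\<^sub>R p"
proof -
  have *: "fst p * snd q = snd p * fst q" using assms by (simp add: cross_def)
  show ?thesis
  proof (cases "fst p = 0")
    case True
    then have "snd p \<noteq> 0" using assms by (auto simp: prod_eq_iff)
    with True * show ?thesis
      by (intro that[of "snd q / snd p"]) (auto simp: prod_eq_iff field_simps)
  next
    case False
    with * show ?thesis
      by (intro that[of "fst q / fst p"]) (auto simp: prod_eq_iff field_simps)
  qed
qed

text \<open>For t outside the unit interval one of a, b would lie strictly between z and the other.
  So the line through two extreme points meets K in no more than their chord.\<close>

lemma extreme_point_line:
  fixes K :: "(real \<times> real) set"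
  assumes "a extreme_point_of K" "b extreme_point_of K" "a \<noteq> b" "z \<in> K"
    and z: "z = a + t *\<^sub>R (b - a)"
  shows "0 \<le> t \<and> t \<le> 1"
proof (rule ccontr)
  assume "\<not> ?thesis"
  then consider "t < 0" | "t > 1" by linarith
  then show False
  proof cases
    case 1
    \<comment> \<open>Solving z = a + t (b - a) for a gives a = c z + (1 - c) b; for t < 0 both
      weights are positive.\<close>
    define c where "c = 1 / (1 - t)"
    have c: "t * c = c - 1" "0 < c" "c < 1" using 1 by (auto simp: c_def field_simps)
    have *: "(1 - (1 - c)) * (p + t * (q - p)) + (1 - c) * q = p" for p q
      using c(1) by algebra
    have "a = (1 - (1 - c)) *\<^sub>R z + (1 - c) *\<^sub>R b"
      using *[of "fst a" "fst b"] *[of "snd a" "snd b"] by (simp add: z prod_eq_iff)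
    moreover have "z \<noteq> b"
    proof
      assume "z = b"
      then have "(t - 1) *\<^sub>R (b - a) = 0" by (simp add: z algebra_simps)
      then show False using 1 assms by auto
    qed
    ultimately have "a \<in> open_segment z b"
      using c unfolding in_segment by (intro conjI exI[of _ "1 - c"]) auto
    then show False using assms by (auto simp: extreme_point_of_def)
  next
    case 2
    define c where "c = 1 / t"
    have c: "t * c = 1" "0 < c" "c < 1" using 2 by (auto simp: c_def field_simps)
    have *: "(1 - (1 - c)) * (p + t * (q - p)) + (1 - c) * p = q" for p q
      using c(1) by algebra
    have "b = (1 - (1 - c)) *\<^sub>R z + (1 - c) *\<^sub>R a"
      using *[of "fst a" "fst b"] *[of "snd a" "snd b"] by (simp add: z prod_eq_iff)
    moreover have "z \<noteq> a" using 2 assms by (auto simp: z)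
    ultimately have "b \<in> open_segment z a"
      using c unfolding in_segment by (intro conjI exI[of _ "1 - c"]) auto
    then show False using assms by (auto simp: extreme_point_of_def)
  qed
qed

lemma cross_extreme_neq_0:
  fixes K :: "(real \<times> real) set"
  assumes "a extreme_point_of K" "b extreme_point_of K" "c extreme_point_of K"
    and ne: "a \<noteq> b" "a \<noteq> c" "b \<noteq> c"
  shows "cross (b - a) (c - a) \<noteq> 0"
proof
  assume "cross (b - a) (c - a) = 0"
  then obtain t where t: "c - a = t *\<^sub>R (b - a)" using cross_eq_0D ne by (metis eq_iff_diff_eq_0)
  then have c: "c = a + t *\<^sub>R (b - a)" by (simp add: algebra_simps)
  have "c \<in> K" using assms by (simp add: extreme_point_of_def)
  then have "0 \<le> t \<and> t \<le> 1" using extreme_point_line[OF assms(1,2) ne(1) _ c] by blast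
  moreover have "t \<noteq> 0" "t \<noteq> 1" using c ne by auto
  ultimately have "c \<in> open_segment a b"
    unfolding in_segment using ne
    by (intro conjI exI[of _ t]) (auto simp: c algebra_simps)
  then show False using assms by (auto simp: extreme_point_of_def)
qed

lemma cross_affine: "u + v = 1 \<Longrightarrow> cross d (u *\<^sub>R x + v *\<^sub>R y - a) = u * cross d (x - a) + v * cross d (y - a)"
proof -
  assume "u + v = 1"
  then have v: "v = 1 - u" by simp
  show ?thesis by (simp add: v cross_def algebra_simps)
qed

text \<open>The sign of \<open>\<sigma>\<close> selects the side of the chord.\<close>

lemma hull_halfplane:
  fixes S :: "(real \<times> real) set"
  assumes ext: "a extreme_point_of convex hull S" "b extreme_point_of convex hull S"
    and "a \<noteq> b" and z: "z \<in> convex hull S" "0 \<le> \<sigma> * cross (b - a) (z - a)" and "\<sigma> \<noteq> 0"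
  shows "z \<in> convex hull {x \<in> S. 0 \<le> \<sigma> * cross (b - a) (x - a)}"
proof -
  define f where "f = (\<lambda>x. \<sigma> * cross (b - a) (x - a))"
  define Sp where "Sp = {x \<in> S. 0 \<le> f x}"
  define Sm where "Sm = {x \<in> S. f x < 0}"
  have abS: "a \<in> S" "b \<in> S" using ext extreme_point_of_convex_hull by auto
  then have ab: "a \<in> Sp" "b \<in> Sp" by (auto simp: Sp_def f_def cross_def)
  have aff: "u + v = 1 \<Longrightarrow> f (u *\<^sub>R x + v *\<^sub>R y) = u * f x + v * f y" for u v x y
    by (simp add: f_def cross_affine) (simp add: algebra_simps)
  have cp: "convex {x. 0 \<le> f x}" "convex {x. f x < 0}"
    unfolding convex_def using aff
    by (auto intro!: add_nonneg_nonneg mult_nonneg_nonneg)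
      (smt (verit, best) mult_nonneg_nonpos mult_pos_neg mult_zero_left)+
  have hp: "0 \<le> f x" if "x \<in> convex hull Sp" for x
    using that hull_minimal[of Sp "{x. 0 \<le> f x}" convex] cp by (auto simp: Sp_def)
  have hm: "f x < 0" if "x \<in> convex hull Sm" for x
    using that hull_minimal[of Sm "{x. f x < 0}" convex] cp by (auto simp: Sm_def)
  have "S = Sp \<union> Sm" by (auto simp: Sp_def Sm_def)
  have "z \<in> convex hull Sp"
  proof (cases "Sm = {}")
    case True
    then show ?thesis using z \<open>S = Sp \<union> Sm\<close> by simp
  next
    case False
    then have ne: "convex hull Sp \<noteq> {}" "convex hull Sm \<noteq> {}" using ab by auto
    have "z \<in> convex hull (convex hull Sp \<union> convex hull Sm)"
      using z \<open>S = Sp \<union> Sm\<close> by (metis hull_Un_left hull_Un_right)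
    then obtain u v x y where u: "0 \<le> u" "0 \<le> v" "v + u = 1" and x: "x \<in> convex hull Sp"
      and y: "y \<in> convex hull Sm" and zu: "z = v *\<^sub>R x + u *\<^sub>R y"
      unfolding convex_hull_union_two[OF convex_convex_hull ne(1) convex_convex_hull ne(2)]
      by blast
    have v: "v = 1 - u" using u by simp
    have fx: "0 \<le> f x" and fy: "f y < 0" using hp x hm y by auto
    \<comment> \<open>\<open>f\<close> is affine along the segment from x to y and vanishes at
      parameter s, so r is where the segment crosses the line through a and b. It crosses within the
      chord, whose ends belong to \<open>Sp\<close>.\<close>
    define s where "s = f x / (f x - f y)"
    have s: "0 \<le> s" "s < 1" "s \<le> 1" using fx fy by (auto simp: s_def field_simps)
    define r where "r = (1 - s) *\<^sub>R x + s *\<^sub>R y"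
    have "f r = (1 - s) * f x + s * f y" unfolding r_def by (rule aff) simp
    also have "\<dots> = 0" using fx fy by (simp add: s_def field_simps)
    finally have "cross (b - a) (r - a) = 0" using \<open>\<sigma> \<noteq> 0\<close> by (simp add: f_def)
    then obtain t where "r - a = t *\<^sub>R (b - a)" using cross_eq_0D \<open>a \<noteq> b\<close> by (metis eq_iff_diff_eq_0)
    then have t: "r = a + t *\<^sub>R (b - a)" by (simp add: algebra_simps)
    have "x \<in> convex hull S" "y \<in> convex hull S"
      using x y hull_mono[of Sp S] hull_mono[of Sm S] by (auto simp: Sp_def Sm_def)
    then have "r \<in> convex hull S" unfolding r_def using s by (intro convexD) auto
    then have "0 \<le> t \<and> t \<le> 1" using extreme_point_line[OF ext \<open>a \<noteq> b\<close> _ t] by blast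
    moreover have "r = (1 - t) *\<^sub>R a + t *\<^sub>R b" by (simp add: t algebra_simps)
    moreover have "a \<in> convex hull Sp" "b \<in> convex hull Sp" using ab by (auto intro: hull_inc)
    ultimately have r: "r \<in> convex hull Sp" by (auto intro!: convexD)
    have "0 \<le> f z" using z by (simp add: f_def)
    moreover have "f z = (1 - u) * f x + u * f y" unfolding zu v by (rule aff) simp
    \<comment> \<open>Since f z \<ge> 0, the point z does not come after the crossing point: it lies
      between x and r, both in the hull of \<open>Sp\<close>.\<close>
    ultimately have us: "u \<le> s" using fx fy by (simp add: s_def field_simps)
    show ?thesis
    proof (cases "s = 0")
      case True
      then show ?thesis using us u x zu v by simp
    next
      case False
      have "z = (1 - u / s) *\<^sub>R x + (u / s) *\<^sub>R r"
        using False by (simp add: zu v r_def algebra_simps)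
      then show ?thesis using x r us u s False
        by (auto intro!: convexD simp: field_simps)
    qed
  qed
  then show ?thesis by (simp add: Sp_def f_def)
qed

text \<open>Cutting along a chord between two extreme points creates no new vertices, so each half
  is the hull of the given points on its side. The halves overlap in part of a line only.\<close>

lemma measure_hull_split:
  fixes S :: "(real \<times> real) set"
  assumes "finite S" "a extreme_point_of convex hull S" "b extreme_point_of convex hull S" "a \<noteq> b"
  shows "measure lebesgue (convex hull S) =
    measure lebesgue (convex hull {x \<in> S. 0 \<le> cross (b - a) (x - a)}) +
    measure lebesgue (convex hull {x \<in> S. cross (b - a) (x - a) \<le> 0})"
proof -
  let ?P = "{x \<in> S. 0 \<le> cross (b - a) (x - a)}" and ?M = "{x \<in> S. cross (b - a) (x - a) \<le> 0}"
  have sub: "convex hull ?P \<subseteq> {x. 0 \<le> cross (b - a) (x - a)}"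
    "convex hull ?M \<subseteq> {x. cross (b - a) (x - a) \<le> 0}"
    by (rule hull_minimal; auto simp: convex_def cross_affine mult_nonneg_nonneg
        add_nonpos_nonpos mult_nonneg_nonpos)+
  have "convex hull S = convex hull ?P \<union> convex hull ?M"
  proof (intro equalityI subsetI)
    fix z assume z: "z \<in> convex hull S"
    show "z \<in> convex hull ?P \<union> convex hull ?M"
    proof (cases "0 \<le> cross (b - a) (z - a)")
      case True
      then show ?thesis using hull_halfplane[OF assms(2-4) z, of 1] by simp
    next
      case False
      then show ?thesis using hull_halfplane[OF assms(2-4) z, of "-1"] by simp
    qed
  next
    fix z assume "z \<in> convex hull ?P \<union> convex hull ?M"
    moreover have "convex hull ?P \<subseteq> convex hull S" "convex hull ?M \<subseteq> convex hull S"
      by (rule hull_mono, blast)+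
    ultimately show "z \<in> convex hull S" by blast
  qed
  moreover have "negligible (convex hull ?P \<inter> convex hull ?M)"
  proof (rule negligible_subset[OF negligible_line[of "b - a" a]])
    show "b - a \<noteq> 0" using assms by simp
    show "convex hull ?P \<inter> convex hull ?M \<subseteq> {z. cross (b - a) (z - a) = 0}"
      using sub by (blast intro: antisym)
  qed
  moreover have "convex hull ?P \<in> lmeasurable" "convex hull ?M \<in> lmeasurable"
    using assms by (auto intro!: lmeasurable_compact finite_imp_compact_convex_hull)
  ultimately show ?thesis
    using measure_Un3_negligible[of "convex hull ?P" "convex hull ?M" "{}"] by simp
qed

text \<open>The three products multiply to minus the square of
  \<open>cross u v * cross u w * cross v w\<close>, so they cannot all be positive. Geometrically,
  the line spanned by one of the vectors strictly separates the other two.\<close>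

lemma cross_opposite_signs:
  fixes u v w :: "real \<times> real"
  assumes "cross u v \<noteq> 0" "cross u w \<noteq> 0" "cross v w \<noteq> 0"
  obtains "cross u v * cross u w < 0" | "cross v u * cross v w < 0" | "cross w u * cross w v < 0"
proof -
  have anti: "cross v u = - cross u v" "cross w u = - cross u w" "cross w v = - cross v w"
    by (auto simp: cross_def)
  show ?thesis
    using that assms unfolding anti by (auto simp: mult_less_0_iff zero_less_mult_iff neq_iff)
qed

lemma card_ge_4_obtain:
  assumes "finite S" "card S \<ge> 4"
  obtains p a b c where "p \<in> S" "a \<in> S" "b \<in> S" "c \<in> S" "p \<noteq> a" "p \<noteq> b" "p \<noteq> c" "a \<noteq> b" "a \<noteq> c" "b \<noteq> c"
proof -
  obtain T where T: "T \<subseteq> S" "card T = 4" using assms by (meson obtain_subset_with_card_n)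
  then have "card T = Suc (Suc (Suc (Suc 0)))" by simp
  then show ?thesis using T(1) that unfolding card_Suc_eq by (elim exE conjE) auto
qed

lemma measure_lattice_hull:
  fixes S :: "(real \<times> real) set"
  assumes "finite S" "\<And>p. p \<in> S \<Longrightarrow> fst p \<in> \<int> \<and> snd p \<in> \<int>"
  shows "2 * measure lebesgue (convex hull S) \<in> \<int>"
  using assms
proof (induction "card S" arbitrary: S rule: less_induct)
  case less
  let ?K = "convex hull S"
  have tri: "2 * measure lebesgue (convex hull {a, b, c}) \<in> \<int>"
    if "a \<in> S" "b \<in> S" "c \<in> S" for a b c
    using less.prems(2)[OF that(1)] less.prems(2)[OF that(2)] less.prems(2)[OF that(3)]
    unfolding measure_triangle cross_def by auto
  have IH: "2 * measure lebesgue (convex hull T) \<in> \<int>" if "T \<subset> S" for T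
    using that less.prems by (intro less.hyps) (auto intro: psubset_card_mono finite_subset)
  consider "\<exists>x\<in>S. \<not> x extreme_point_of ?K" | "card S \<le> 3"
    | "card S \<ge> 4" "\<forall>x\<in>S. x extreme_point_of ?K"
    by (cases "card S \<le> 3") auto
  then show ?case
  proof cases
    case 1
    have "?K = convex hull {x. x extreme_point_of ?K}"
      using Krein_Milman_polytope[OF less.prems(1)] .
    moreover have "{x. x extreme_point_of ?K} \<subset> S"
      using 1 extreme_point_of_convex_hull by auto
    ultimately show ?thesis using IH by metis
  next
    case 2
    then consider "card S = 0" | "card S = 1" | "card S = 2" | "card S = 3" by linarith
    then show ?thesis
    proof cases
      assume "card S = 0"
      then show ?thesis using less.prems by auto
    next
      assume "card S = 1"
      then obtain a where "S = {a}" by (auto simp: card_1_singleton_iff)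
      \<comment> \<open>Repeated vertices make the smaller sets degenerate triangles.\<close>
      then show ?thesis using tri[of a a a] by auto
    next
      assume "card S = 2"
      then obtain a b where "S = {a, b}" by (auto simp: card_2_iff)
      then show ?thesis using tri[of a b b] by auto
    next
      assume "card S = 3"
      then obtain a b c where "S = {a, b, c}" by (auto simp: card_3_iff)
      then show ?thesis using tri[of a b c] by auto
    qed
  next
    case 3
    have split: "2 * measure lebesgue ?K \<in> \<int>"
      if *: "p \<in> S" "a \<in> S" "b \<in> S" "c \<in> S" "p \<noteq> a"
        "cross (a - p) (b - p) * cross (a - p) (c - p) < 0" for p a b c
    proof -
      from *(6) have "cross (a - p) (b - p) < 0 \<and> cross (a - p) (c - p) > 0 \<or>
          cross (a - p) (b - p) > 0 \<and> cross (a - p) (c - p) < 0"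
        by (auto simp: mult_less_0_iff)
      then have "{x \<in> S. 0 \<le> cross (a - p) (x - p)} \<subset> S" "{x \<in> S. cross (a - p) (x - p) \<le> 0} \<subset> S"
        using *(3,4) by force+
      then show ?thesis
        using 3 * less.prems(1)
        by (subst measure_hull_split[of S p a]) (auto simp: distrib_left intro!: Ints_add IH)
    qed
    obtain p a b c where pabc: "p \<in> S" "a \<in> S" "b \<in> S" "c \<in> S"
      and ne: "p \<noteq> a" "p \<noteq> b" "p \<noteq> c" "a \<noteq> b" "a \<noteq> c" "b \<noteq> c"
      using card_ge_4_obtain 3 less.prems(1) by metis
    have "cross (a - p) (b - p) \<noteq> 0" "cross (a - p) (c - p) \<noteq> 0" "cross (b - p) (c - p) \<noteq> 0"
      using 3 pabc ne by (intro cross_extreme_neq_0[of _ ?K]; blast)+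
    then show ?thesis
      using split[OF pabc(1,2,3,4)] split[OF pabc(1,3,2,4)] split[OF pabc(1,4,2,3)] ne
        cross_opposite_signs by metis
  qed
qed

section \<open>The upper bound\<close>

lemma closed_slice: "closed K \<Longrightarrow> closed (Pair x -` K)" for K :: "(real \<times> real) set"
  by (rule closed_vimage) (auto intro!: continuous_intros)

lemma sets_pair_compact: "compact K \<Longrightarrow> K \<in> sets (lborel \<Otimes>\<^sub>M lborel)" for K :: "(real \<times> real) set"
  unfolding lborel_prod by (simp add: borel_compact)

lemma emeasure_slices:
  fixes K :: "(real \<times> real) set"
  assumes "compact K"
  shows "emeasure lborel K = (\<integral>\<^sup>+x. emeasure lborel (Pair x -` K) \<partial>lborel)"
proof -
  note sets_pair_compact[OF assms]
  then show ?thesis by (subst lborel_prod[symmetric]) (rule lborel.emeasure_pair_measure_alt)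
qed

lemma emeasure_eq_measure_compact:
  fixes K :: "(real \<times> real) set"
  assumes "compact K"
  shows "emeasure lborel K = ennreal (measure lebesgue K)"
proof -
  have "K \<in> sets borel" using assms by (rule borel_compact)
  moreover have "emeasure lborel K < \<infinity>" using assms by (rule emeasure_compact_finite)
  ultimately show ?thesis by (simp add: measure_completion emeasure_eq_ennreal_measure)
qed

lemma measure_slices:
  fixes K :: "(real \<times> real) set"
  assumes "compact K" "\<And>x. 0 \<le> g x" "g \<in> borel_measurable borel"
    and "\<And>x. emeasure lborel (Pair x -` K) = ennreal (g x)"
    and I: "(g has_integral I) UNIV"
  shows "measure lebesgue K = I"
proof -
  have "ennreal (measure lebesgue K) = ennreal I"
    using nn_integral_has_integral_lborel[OF assms(3,2) I] assms(4)
    by (simp add: emeasure_slices[OF assms(1)] flip: emeasure_eq_measure_compact[OF assms(1)])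
  moreover have "0 \<le> I" using has_integral_nonneg[OF I] assms(2) by blast
  ultimately show ?thesis by simp
qed

lemma has_integral_affine:
  fixes c d p q :: real
  assumes "c \<le> d"
  shows "((\<lambda>x. p + q * x) has_integral (d - c) * (p + q * (c + d) / 2)) {c..d}"
proof -
  have "((\<lambda>x. p + q * x) has_integral (d - c) * p + q * ((d\<^sup>2 - c\<^sup>2) / 2)) {c..d}"
    using assms by (intro has_integral_add has_integral_mult_right ident_has_integral)
      (use has_integral_const_real[of p c d] in auto)
  moreover have "(d - c) * p + q * ((d\<^sup>2 - c\<^sup>2) / 2) = (d - c) * (p + q * (c + d) / 2)"
    by (simp add: power2_eq_square field_simps)
  ultimately show ?thesis by simp
qed

text \<open>Slicing in the other coordinate. This reduces horizontal additions of cells to vertical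
  ones.\<close>

lemma measure_swap:
  fixes K :: "(real \<times> real) set"
  assumes "compact K"
  shows "measure lebesgue (prod.swap ` K) = measure lebesgue K"
proof -
  have c: "compact (prod.swap ` K)"
    using assms by (intro compact_continuous_image continuous_on_swap)
  note K = sets_pair_compact[OF assms] and K' = sets_pair_compact[OF c]
  have psf: "pair_sigma_finite (lborel :: real measure) (lborel :: real measure)"
    by (simp add: pair_sigma_finite_def lborel.sigma_finite_measure_axioms)
  have "emeasure (lborel \<Otimes>\<^sub>M lborel) (prod.swap ` K) =
      (\<integral>\<^sup>+x. emeasure lborel ((\<lambda>y. (y, x)) -` (prod.swap ` K)) \<partial>lborel)"
    by (rule pair_sigma_finite.emeasure_pair_measure_alt2[OF psf K'])
  also have "\<dots> = (\<integral>\<^sup>+x. emeasure lborel (Pair x -` K) \<partial>lborel)"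
    by (intro nn_integral_cong arg_cong2[where f = emeasure]) (force simp: image_iff)+
  also have "\<dots> = emeasure (lborel \<Otimes>\<^sub>M lborel) K"
    by (rule lborel.emeasure_pair_measure_alt[OF K, symmetric])
  finally show ?thesis
    using emeasure_eq_measure_compact[OF c] emeasure_eq_measure_compact[OF assms]
    by (simp add: lborel_prod)
qed

text \<open>Over \<open>{B..T}\<close> the graph bounds a trapezoid of height 1 with parallel sides
  T - B and 1, whence the integral 1 + (T - B - 1) / 2. If s = B or T = s + 1, the branch with the
  zero denominator applies only outside \<open>{B..T}\<close>.\<close>

definition tent :: "real \<Rightarrow> real \<Rightarrow> real \<Rightarrow> real \<Rightarrow> real" where
  "tent B s T x = (if x < s then (x - B) / (s - B) else if x \<le> s + 1 then 1 else (T - x) / (T - s - 1))"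

lemma tent_nonneg: "B \<le> s \<Longrightarrow> s + 1 \<le> T \<Longrightarrow> x \<in> {B..T} \<Longrightarrow> 0 \<le> tent B s T x"
  by (auto simp: tent_def)

lemma has_integral_tent:
  assumes "B \<le> s" "s + 1 \<le> T"
  shows "(tent B s T has_integral 1 + (T - B - 1) / 2) {B..T}"
proof -
  have 1: "(tent B s T has_integral (s - B) / 2) {B..s}"
  proof (cases "B = s")
    case False
    have "((\<lambda>x. - B / (s - B) + (1 / (s - B)) * x) has_integral
        (s - B) * (- B / (s - B) + (1 / (s - B)) * (B + s) / 2)) {B..s}"
      using assms by (intro has_integral_affine)
    moreover have "(s - B) * (- B / (s - B) + (1 / (s - B)) * (B + s) / 2) = (s - B) / 2"
      using False by (simp add: divide_simps) (simp add: algebra_simps)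
    moreover have "tent B s T x = - B / (s - B) + (1 / (s - B)) * x" if "x \<in> {B..s}" for x
    proof -
      have "tent B s T x = (x - B) / (s - B)" using that False assms by (auto simp: tent_def)
      then show ?thesis by (simp add: diff_divide_distrib)
    qed
    ultimately show ?thesis by (metis (no_types, lifting) has_integral_cong)
  qed (auto intro: has_integral_refl)
  have 2: "(tent B s T has_integral 1) {s..s + 1}"
  proof -
    have "((\<lambda>x. 1 :: real) has_integral 1) {s..s + 1}"
      using has_integral_const_real[of "1 :: real" s "s + 1"] by simp
    moreover have "tent B s T x = 1" if "x \<in> {s..s + 1}" for x
      using that assms by (auto simp: tent_def)
    ultimately show ?thesis by (metis (no_types, lifting) has_integral_cong)
  qed
  have 3: "(tent B s T has_integral (T - s - 1) / 2) {s + 1..T}"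
  proof (cases "T = s + 1")
    case False
    have "((\<lambda>x. T / (T - s - 1) + (- 1 / (T - s - 1)) * x) has_integral
        (T - (s + 1)) * (T / (T - s - 1) + (- 1 / (T - s - 1)) * (s + 1 + T) / 2)) {s + 1..T}"
      using assms by (intro has_integral_affine)
    moreover have "(T - (s + 1)) * (T / (T - s - 1) + (- 1 / (T - s - 1)) * (s + 1 + T) / 2) =
        (T - s - 1) / 2"
      using False by (simp add: divide_simps) (simp add: algebra_simps)
    moreover have "tent B s T x = T / (T - s - 1) + (- 1 / (T - s - 1)) * x" if "x \<in> {s + 1..T}" for x
      using that False assms by (auto simp: tent_def divide_simps)
    ultimately show ?thesis by (metis (no_types, lifting) has_integral_cong)
  qed (auto intro: has_integral_refl)
  have "(tent B s T has_integral (s - B) / 2 + 1 + (T - s - 1) / 2) {B..T}"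
    using assms
    by (intro has_integral_combine[OF _ _ has_integral_combine[OF _ _ 1 2] 3]) auto
  moreover have "(s - B) / 2 + 1 + (T - s - 1) / 2 = 1 + (T - B - 1) / 2" by (simp add: field_simps)
  ultimately show ?thesis by simp
qed

text \<open>A share u of q keeps the mixed point at distance at least u (s - B) from B and at least
  u (T - s - 1) from T; the tent is the largest u up to 1 that these two conditions permit.\<close>

lemma le_tent:
  assumes "B \<le> s" "s + 1 \<le> T" "0 \<le> u" "u \<le> 1" "k \<in> {B..T}" "q \<in> {s..s + 1}"
  shows "u \<le> tent B s T ((1 - u) * k + u * q)"
proof -
  define x where "x = (1 - u) * k + u * q"
  have "(1 - u) * B + u * s \<le> x" unfolding x_def
    using assms by (intro add_mono mult_left_mono) auto
  moreover have "x \<le> (1 - u) * T + u * (s + 1)" unfolding x_def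
    using assms by (intro add_mono mult_left_mono) auto
  ultimately have "u * (s - B) \<le> x - B" "u * (T - s - 1) \<le> T - x" by (auto simp: algebra_simps)
  moreover have "B \<le> x" "x \<le> T"
    using assms convexD[of "{B..T}" k q "1 - u" u] by (auto simp: x_def)
  ultimately show ?thesis using assms
    by (auto simp: tent_def pos_le_divide_eq simp flip: x_def)
qed

lemma slice_interval:
  fixes K :: "(real \<times> real) set"
  assumes "compact K" "convex K"
  obtains l r where "Pair x -` K = {l..r}"
proof -
  have "compact (Pair x -` K)"
  proof -
    have "Pair x -` K \<subseteq> snd ` K" by force
    moreover have "bounded (snd ` K)"
      using assms by (intro compact_imp_bounded compact_continuous_image continuous_intros)
    ultimately show ?thesis
      using closed_slice assms compact_imp_closed by (metis bounded_subset compact_eq_bounded_closed)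
  qed
  moreover have "convex (Pair x -` K)"
  proof (rule convexI)
    fix y z u v :: real
    assume "y \<in> Pair x -` K" "z \<in> Pair x -` K" and uv: "0 \<le> u" "0 \<le> v" "u + v = 1"
    then have "u *\<^sub>R (x, y) + v *\<^sub>R (x, z) \<in> K" using assms by (intro convexD) auto
    moreover have "u * x + v * x = x" using uv by (metis distrib_right mult_1)
    ultimately show "u *\<^sub>R y + v *\<^sub>R z \<in> Pair x -` K" by simp
  qed
  ultimately show ?thesis using that connected_compact_interval_1 convex_connected by metis
qed

text \<open>A point of the new hull is v k + u q with k in K and q in Q. Exchanging q for its
  translate in K moves the point vertically by u and puts it into K, and \<open>le_tent\<close>
  bounds u in terms of the abscissa alone. The claim follows by integrating over the slices.\<close>

lemma measure_hull_insert:
  fixes K Q :: "(real \<times> real) set"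
  assumes K: "compact K" "convex K" "K \<subseteq> {B..T} \<times> UNIV"
    and Q: "compact Q" "convex Q" "Q \<noteq> {}" "Q \<subseteq> {s..s + 1} \<times> UNIV"
    and BT: "B \<le> s" "s + 1 \<le> T" and "\<bar>\<sigma>\<bar> = 1"
    and shift: "\<And>q. q \<in> Q \<Longrightarrow> q - (0, \<sigma>) \<in> K"
  shows "measure lebesgue (convex hull (K \<union> Q)) \<le> measure lebesgue K + 1 + (T - B - 1) / 2"
proof -
  let ?H = "convex hull (K \<union> Q)"
  define w where "w x = (if x \<in> {B..T} then tent B s T x else 0)" for x
  have w0: "0 \<le> w x" for x using BT by (auto simp: w_def intro!: tent_nonneg)
  have wm: "w \<in> borel_measurable borel" unfolding w_def[abs_def] tent_def by measurable
  have wI: "(w has_integral 1 + (T - B - 1) / 2) UNIV"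
    unfolding w_def[abs_def] has_integral_restrict_UNIV by (rule has_integral_tent[OF BT])
  have "K \<noteq> {}" using Q shift by blast
  have H: "compact ?H" using K Q by (intro compact_convex_hull compact_Un)
  have slice: "\<exists>u. 0 \<le> u \<and> u \<le> w x \<and> (x, y - u * \<sigma>) \<in> K" if "(x, y) \<in> ?H" for x y
  proof -
    from that obtain v u k q where vu: "0 \<le> v" "0 \<le> u" "v + u = 1" and k: "k \<in> K" and q: "q \<in> Q"
      and xy: "(x, y) = v *\<^sub>R k + u *\<^sub>R q"
      unfolding convex_hull_union_two[OF K(2) \<open>K \<noteq> {}\<close> Q(2,3)] by blast
    have v: "v = 1 - u" using vu by simp
    have "fst k \<in> {B..T}" "fst q \<in> {s..s + 1}" using k q K Q by force+
    then have "u \<le> tent B s T ((1 - u) * fst k + u * fst q)" "(1 - u) * fst k + u * fst q \<in> {B..T}"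
      using vu BT convexD[of "{B..T}" "fst k" "fst q" "1 - u" u]
      by (auto intro!: le_tent)
    moreover have x: "x = (1 - u) * fst k + u * fst q" using arg_cong[OF xy, of fst] by (simp add: v)
    ultimately have "u \<le> w x" by (simp add: w_def)
    moreover have "v *\<^sub>R k + u *\<^sub>R (q - (0, \<sigma>)) \<in> K" using K vu k shift[OF q] by (intro convexD)
    moreover have "v *\<^sub>R k + u *\<^sub>R (q - (0, \<sigma>)) = (x, y) - u *\<^sub>R (0, \<sigma>)"
      by (simp add: xy algebra_simps)
    ultimately show ?thesis using vu by auto
  qed
  have le: "emeasure lborel (Pair x -` ?H) \<le> emeasure lborel (Pair x -` K) + ennreal (w x)" for x
  proof (cases "Pair x -` ?H = {}")
    case False
    obtain l r where lr: "Pair x -` K = {l..r}" using slice_interval K by metis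
    have in_K: "\<exists>u. 0 \<le> u \<and> u \<le> w x \<and> l \<le> y - u * \<sigma> \<and> y - u * \<sigma> \<le> r" if "y \<in> Pair x -` ?H" for y
      using slice[of x y] that lr by (auto simp: set_eq_iff)
    have "l \<le> r" using in_K False by fastforce
    \<comment> \<open>All displacements have the sign of \<sigma>, so the slice is extended at one
      end only, by at most \<open>w x\<close>.\<close>
    have "\<exists>a b. Pair x -` ?H \<subseteq> {a..b} \<and> a \<le> b \<and> b - a = r - l + w x"
    proof (cases "\<sigma> = 1")
      case True
      then have "Pair x -` ?H \<subseteq> {l..r + w x}" using in_K by fastforce
      then show ?thesis using w0[of x] \<open>l \<le> r\<close> by (intro exI[of _ l] exI[of _ "r + w x"]) auto
    next
      case False
      then have "\<sigma> = - 1" using \<open>\<bar>\<sigma>\<bar> = 1\<close> by linarith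
      then have "Pair x -` ?H \<subseteq> {l - w x..r}" using in_K by fastforce
      then show ?thesis using w0[of x] \<open>l \<le> r\<close> by (intro exI[of _ "l - w x"] exI[of _ r]) auto
    qed
    then obtain a b where ab: "Pair x -` ?H \<subseteq> {a..b}" "a \<le> b" "b - a = r - l + w x" by blast
    have "emeasure lborel (Pair x -` ?H) \<le> emeasure lborel {a..b}" by (intro emeasure_mono ab) simp
    also have "\<dots> = ennreal (r - l) + ennreal (w x)" using ab w0[of x] \<open>l \<le> r\<close> by (simp flip: ennreal_plus)
    finally show ?thesis using \<open>l \<le> r\<close> by (simp add: lr)
  qed simp
  have Km: "(\<lambda>x. emeasure lborel (Pair x -` K)) \<in> borel_measurable lborel"
    by (intro lborel.measurable_emeasure_Pair sets_pair_compact K)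
  have "emeasure lborel ?H \<le> (\<integral>\<^sup>+x. emeasure lborel (Pair x -` K) + ennreal (w x) \<partial>lborel)"
    unfolding emeasure_slices[OF H] by (intro nn_integral_mono le)
  also have "\<dots> = (\<integral>\<^sup>+x. emeasure lborel (Pair x -` K) \<partial>lborel) + (\<integral>\<^sup>+x. ennreal (w x) \<partial>lborel)"
    using Km wm by (intro nn_integral_add) auto
  also have "\<dots> = emeasure lborel K + ennreal (1 + (T - B - 1) / 2)"
    by (simp add: emeasure_slices[OF K(1)] nn_integral_has_integral_lborel[OF wm w0 wI])
  also have "\<dots> = ennreal (measure lebesgue K + (1 + (T - B - 1) / 2))"
    using BT by (subst emeasure_eq_measure_compact[OF K(1)]) (simp flip: ennreal_plus)
  finally have "ennreal (measure lebesgue ?H) \<le> ennreal (measure lebesgue K + (1 + (T - B - 1) / 2))"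
    by (simp only: emeasure_eq_measure_compact[OF H])
  then show ?thesis using BT by (subst (asm) ennreal_le_iff) auto
qed

section \<open>Unit squares and hulls of polyominoes\<close>

lemma unit_square_eq: "unit_square (i, j) = {of_int i..of_int i + 1} \<times> {of_int j..of_int j + 1}"
  by (simp add: unit_square_def cbox_Pair_eq)

lemma unit_square_props: "compact (unit_square c)" "convex (unit_square c)" "unit_square c \<noteq> {}"
  by (cases c, auto simp: unit_square_eq intro!: compact_Times convex_Times)+

lemma measure_unit_square: "measure lebesgue (unit_square c) = 1"
  by (simp add: unit_square_def content_Pair)

lemma unit_square_subset_hull: "c \<in> P \<Longrightarrow> unit_square c \<subseteq> polyomino_hull P"
  unfolding polyomino_hull_def by (rule order_trans[OF _ hull_subset]) blast

lemma polyomino_hull_subset: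
  "convex C \<Longrightarrow> (\<And>c. c \<in> P \<Longrightarrow> unit_square c \<subseteq> C) \<Longrightarrow> polyomino_hull P \<subseteq> C"
  unfolding polyomino_hull_def by (intro hull_minimal) auto

lemma convex_polyomino_hull: "convex (polyomino_hull P)"
  by (simp add: polyomino_hull_def)

lemma compact_polyomino_hull: "finite P \<Longrightarrow> compact (polyomino_hull P)"
  unfolding polyomino_hull_def by (intro compact_convex_hull compact_UN unit_square_props)

lemma polyomino_hull_insert:
  "polyomino_hull (insert d P) = convex hull (polyomino_hull P \<union> unit_square d)"
  unfolding polyomino_hull_def using hull_Un_right[of convex "unit_square d" "\<Union>(unit_square ` P)"]
  by (simp add: Un_commute)

lemma polyomino_hull_swap: "polyomino_hull (prod.swap ` P) = prod.swap ` polyomino_hull P"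
proof -
  have "linear (prod.swap :: real \<times> real \<Rightarrow> real \<times> real)" by (intro linearI) auto
  moreover have "unit_square (prod.swap c) = prod.swap ` unit_square c" for c
    by (cases c) (auto simp: unit_square_eq)
  ultimately show ?thesis
    unfolding polyomino_hull_def by (simp add: convex_hull_linear_image image_UN)
qed

lemma measure_hull_insert_vertical:
  assumes "finite P" "c \<in> P" "fst d = fst c" "\<bar>snd c - snd d\<bar> = 1"
    and A: "fst ` P \<subseteq> {A..A + int x}"
  shows "measure lebesgue (polyomino_hull (insert d P)) \<le> measure lebesgue (polyomino_hull P) + 1 + real x / 2"
proof -
  let ?K = "polyomino_hull P"
  obtain i j l where cd: "c = (i, j)" "d = (i, l)" using assms by (cases c, cases d) auto
  have i: "A \<le> i" "i \<le> A + int x" using A assms(2) by (force simp: cd)+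
  have K: "?K \<subseteq> {real_of_int A..real_of_int (A + int x) + 1} \<times> UNIV"
  proof (intro polyomino_hull_subset convex_Times)
    fix c assume "c \<in> P"
    then have "A \<le> fst c" "fst c \<le> A + int x" using A by force+
    then show "unit_square c \<subseteq> {real_of_int A..real_of_int (A + int x) + 1} \<times> UNIV"
      by (cases c) (auto simp: unit_square_eq)
  qed auto
  have "measure lebesgue (convex hull (?K \<union> unit_square d)) \<le>
      measure lebesgue ?K + 1 + (real_of_int (A + int x) + 1 - real_of_int A - 1) / 2"
  proof (rule measure_hull_insert[OF compact_polyomino_hull convex_polyomino_hull K
        unit_square_props, where s = "real_of_int i" and \<sigma> = "real_of_int (l - j)"])
    show "real_of_int i + 1 \<le> real_of_int (A + int x) + 1" using i by linarith
    show "\<bar>real_of_int (l - j)\<bar> = 1" using assms cd by (simp flip: of_int_abs of_int_diff)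
    show "q - (0, real_of_int (l - j)) \<in> ?K" if "q \<in> unit_square d" for q
    proof -
      have "q - (0, real_of_int (l - j)) \<in> unit_square c" using that
        by (cases q) (auto simp: cd unit_square_eq)
      then show ?thesis using unit_square_subset_hull assms by blast
    qed
  qed (use assms i in \<open>auto simp: cd unit_square_eq\<close>)
  then show ?thesis by (simp add: polyomino_hull_insert)
qed

lemma measure_hull_insert_horizontal:
  assumes "finite P" "c \<in> P" "snd d = snd c" "\<bar>fst c - fst d\<bar> = 1"
    and B: "snd ` P \<subseteq> {B..B + int y}"
  shows "measure lebesgue (polyomino_hull (insert d P)) \<le> measure lebesgue (polyomino_hull P) + 1 + real y / 2"
proof -
  have sw: "measure lebesgue (polyomino_hull (prod.swap ` Q)) = measure lebesgue (polyomino_hull Q)"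
    if "finite Q" for Q
    using that by (simp add: polyomino_hull_swap measure_swap compact_polyomino_hull)
  have "measure lebesgue (polyomino_hull (insert (prod.swap d) (prod.swap ` P))) \<le>
      measure lebesgue (polyomino_hull (prod.swap ` P)) + 1 + real y / 2"
  proof (rule measure_hull_insert_vertical)
    show "finite (prod.swap ` P)" "prod.swap c \<in> prod.swap ` P" using assms by blast+
    show "fst ` prod.swap ` P \<subseteq> {B..B + int y}" using B by (auto simp: image_image)
  qed (use assms in auto)
  then show ?thesis using sw[of P] sw[of "insert d P"] assms(1) by simp
qed

text \<open>A chain from Q to a cell outside Q has a step that leaves Q. This supplies the next cell
  in the growth of a polyomino.\<close>

lemma edge_connected_boundary:
  assumes "edge_connected P" "Q \<subset> P" "Q \<noteq> {}"
  obtains c d where "c \<in> Q" "d \<in> P - Q" "edge_adjacent c d"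
proof -
  let ?R = "{(x, y). x \<in> P \<and> y \<in> P \<and> edge_adjacent x y}"
  obtain p q where pq: "p \<in> Q" "q \<in> P - Q" using assms by blast
  then have "(p, q) \<in> ?R\<^sup>*" using assms unfolding edge_connected_def by blast
  then have "q \<notin> Q \<longrightarrow> (\<exists>c\<in>Q. \<exists>d\<in>P - Q. edge_adjacent c d)"
    by (induction rule: rtrancl_induct) (use pq in auto)
  then show ?thesis using pq that by blast
qed

text \<open>Growing the polyomino cell by cell, \<open>x\<close> counts the horizontal and \<open>y\<close> the vertical additions.\<close>

lemma polyomino_growth:
  assumes "finite P" "edge_connected P" "k < card P"
  shows "\<exists>Q x y A B. Q \<subseteq> P \<and> card Q = Suc k \<and> k = x + y \<and>
    fst ` Q \<subseteq> {A..A + int x} \<and> snd ` Q \<subseteq> {B..B + int y} \<and>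
    measure lebesgue (polyomino_hull Q) \<le> real (Suc k) + real x * real y / 2"
  using assms(3)
proof (induction k)
  case 0
  then obtain c where c: "c \<in> P" by (cases "P = {}") auto
  have "polyomino_hull {c} = unit_square c"
    using unit_square_props(2) by (simp add: polyomino_hull_def hull_same)
  then have "measure lebesgue (polyomino_hull {c}) = 1"
    by (simp add: measure_unit_square)
  then show ?case using c
    by (intro exI[of _ "{c}"] exI[of _ "0 :: nat"] exI[of _ "fst c"] exI[of _ "snd c"]) auto
next
  case (Suc k)
  then obtain Q x y A B where Q: "Q \<subseteq> P" "card Q = Suc k" "k = x + y"
    and A: "fst ` Q \<subseteq> {A..A + int x}" and B: "snd ` Q \<subseteq> {B..B + int y}"
    and m: "measure lebesgue (polyomino_hull Q) \<le> real (Suc k) + real x * real y / 2"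
    using Suc_lessD by blast
  have fin: "finite Q" using Q assms finite_subset by blast
  have "Q \<subset> P" "Q \<noteq> {}" using Q Suc by auto
  then obtain c d where c: "c \<in> Q" and d: "d \<in> P" "d \<notin> Q" and "edge_adjacent c d"
    using edge_connected_boundary assms by (metis DiffE)
  have card: "insert d Q \<subseteq> P" "card (insert d Q) = Suc (Suc k)" using Q d fin by auto
  have cAB: "A \<le> fst c" "fst c \<le> A + int x" "B \<le> snd c" "snd c \<le> B + int y" using A B c by force+
  from \<open>edge_adjacent c d\<close> consider
      "fst d = fst c" "\<bar>snd c - snd d\<bar> = 1" | "snd d = snd c" "\<bar>fst c - fst d\<bar> = 1"
    by (auto simp: edge_adjacent_def)
  then show ?case
  proof cases
    case 1
    have "measure lebesgue (polyomino_hull (insert d Q)) \<le> real (Suc (Suc k)) + real x * real (Suc y) / 2"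
      using measure_hull_insert_vertical[OF fin c 1 A] m by (simp add: field_simps)
    moreover have "fst ` insert d Q \<subseteq> {A..A + int x}" using A cAB 1 by auto
    \<comment> \<open>The new row is at most one off the old range, so lowering the bottom if
      necessary and lengthening the range by one covers it on either side; y only bounds the
      extent.\<close>
    moreover have "snd ` insert d Q \<subseteq> {min B (snd d)..min B (snd d) + int (Suc y)}"
      using B cAB 1 by (fastforce simp: min_def)
    ultimately show ?thesis using card Q
      by (intro exI[of _ "insert d Q"] exI[of _ x] exI[of _ "Suc y"] exI[of _ A] exI[of _ "min B (snd d)"]) auto
  next
    case 2
    have "measure lebesgue (polyomino_hull (insert d Q)) \<le> real (Suc (Suc k)) + real (Suc x) * real y / 2"
      using measure_hull_insert_horizontal[OF fin c 2 B] m by (simp add: field_simps)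
    moreover have "snd ` insert d Q \<subseteq> {B..B + int y}" using B cAB 2 by auto
    moreover have "fst ` insert d Q \<subseteq> {min A (fst d)..min A (fst d) + int (Suc x)}"
      using A cAB 2 by (fastforce simp: min_def)
    ultimately show ?thesis using card Q
      by (intro exI[of _ "insert d Q"] exI[of _ "Suc x"] exI[of _ y] exI[of _ "min A (fst d)"] exI[of _ B]) auto
  qed
qed

text \<open>With s half of the sum, rounded down, x \<le> y gives x \<le> s \<le> y, and (s - x) (y
  - s) \<ge> 0 expands to x y \<le> s (x + y - s).\<close>

lemma mult_le_balanced: "x * y \<le> ((x + y) div 2) * ((x + y + 1) div 2)" for x y :: nat
proof (induction "x" "y" rule: linorder_wlog)
  case (le x y)
  define s where "s = (x + y) div 2"
  have s: "x \<le> s" "s \<le> y" using le by (auto simp: s_def)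
  then have "0 \<le> (int s - int x) * (int y - int s)" by simp
  then have "int (x * y) \<le> int s * (int x + int y - int s)" by (simp add: algebra_simps)
  moreover have "int ((x + y + 1) div 2) = int x + int y - int s" by (simp add: s_def)
  ultimately show ?case by (metis s_def of_nat_mult of_nat_le_iff)
qed (simp add: ac_simps)

lemma polyomino_area_upper:
  assumes "polyomino n P" "n \<ge> 1"
  shows "measure lebesgue (polyomino_hull P) \<le> real n + real (((n - 1) div 2) * (n div 2)) / 2"
proof -
  have P: "finite P" "card P = n" "edge_connected P" using assms by (auto simp: polyomino_def)
  obtain k where k: "n = Suc k" using assms(2) by (cases n) auto
  then have "k < card P" using P by simp
  from polyomino_growth[OF P(1,3) this]
  obtain Q x y where Q: "Q \<subseteq> P" "card Q = Suc k" "k = x + y"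
    and m: "measure lebesgue (polyomino_hull Q) \<le> real (Suc k) + real x * real y / 2"
    by (elim exE conjE) (rule that)
  have "Q = P" using Q P k by (simp add: card_subset_eq)
  moreover have "real x * real y \<le> real (((n - 1) div 2) * (n div 2))"
    using mult_le_balanced[of x y] Q(3) k by (simp flip: of_nat_mult)
  ultimately show ?thesis using m k by simp
qed

section \<open>The lower bound and excess one\<close>

lemma negligible_unit_squares:
  assumes "c \<noteq> d"
  shows "negligible (unit_square c \<inter> unit_square d)"
proof -
  obtain i j k l where cd: "c = (i, j)" "d = (k, l)" by (cases c, cases d)
  have *: "negligible (A \<inter> B)" if "A \<inter> B \<subseteq> {z. z \<bullet> b = r}" "b \<in> Basis" for A B b and r :: real
    using that negligible_standard_hyperplane negligible_subset by blast
  have b: "(1, 0) \<in> (Basis :: (real \<times> real) set)" "(0, 1) \<in> (Basis :: (real \<times> real) set)"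
    by (auto simp: Basis_prod_def)
  consider "i + 1 \<le> k" | "k + 1 \<le> i" | "j + 1 \<le> l" | "l + 1 \<le> j" using assms cd by fastforce
  then show ?thesis
  proof cases
    case 1
    then have "real_of_int i + 1 \<le> real_of_int k" by linarith
    then show ?thesis by (intro *[OF _ b(1), of _ _ "real_of_int k"]) (auto simp: cd unit_square_eq)
  next
    case 2
    then have "real_of_int k + 1 \<le> real_of_int i" by linarith
    then show ?thesis by (intro *[OF _ b(1), of _ _ "real_of_int i"]) (auto simp: cd unit_square_eq)
  next
    case 3
    then have "real_of_int j + 1 \<le> real_of_int l" by linarith
    then show ?thesis by (intro *[OF _ b(2), of _ _ "real_of_int l"]) (auto simp: cd unit_square_eq)
  next
    case 4
    then have "real_of_int l + 1 \<le> real_of_int j" by linarith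
    then show ?thesis by (intro *[OF _ b(2), of _ _ "real_of_int j"]) (auto simp: cd unit_square_eq)
  qed
qed

text \<open>Distinct cells overlap in null sets, so covered parts of missing cells count in full on
  top of the cells of P. An empty D yields the lower bound for the area; for excess one, D consists
  of one or two missing cells.\<close>

lemma measure_hull_ge:
  assumes "finite P" "finite D" "D \<inter> P = {}"
    and T: "\<And>c. c \<in> D \<Longrightarrow> compact (T c) \<and> T c \<subseteq> unit_square c \<inter> polyomino_hull P"
  shows "real (card P) + (\<Sum>c\<in>D. measure lebesgue (T c)) \<le> measure lebesgue (polyomino_hull P)"
proof -
  define F where "F c = (if c \<in> P then unit_square c else T c)" for c
  have F: "compact (F c)" "F c \<subseteq> unit_square c" "F c \<subseteq> polyomino_hull P" if "c \<in> P \<union> D" for c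
    using that T[of c] unit_square_subset_hull[of c P] unit_square_props[of c] by (auto simp: F_def simp del: split_paired_All)
  have m: "F c \<in> lmeasurable" if "c \<in> P \<union> D" for c using F that by (intro lmeasurable_compact)
  have neg: "pairwise (\<lambda>c d. negligible (F c \<inter> F d)) (P \<union> D)"
    unfolding pairwise_def using F negligible_unit_squares by (meson Int_mono negligible_subset)
  have "measure lebesgue (\<Union>(F ` (P \<union> D))) = (\<Sum>c\<in>P \<union> D. measure lebesgue (F c))"
    using assms m neg by (intro measure_negligible_finite_Union_image) auto
  also have "\<dots> = (\<Sum>c\<in>P. measure lebesgue (F c)) + (\<Sum>c\<in>D. measure lebesgue (F c))"
    using assms by (intro sum.union_disjoint) auto
  also have "(\<Sum>c\<in>P. measure lebesgue (F c)) = real (card P)"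
    by (simp add: F_def measure_unit_square)
  also have "(\<Sum>c\<in>D. measure lebesgue (F c)) = (\<Sum>c\<in>D. measure lebesgue (T c))"
    using assms by (intro sum.cong) (auto simp: F_def)
  finally show ?thesis
    using measure_mono_fmeasurable[of "\<Union>(F ` (P \<union> D))" "polyomino_hull P" lebesgue] F assms(1,2) m
      lmeasurable_compact[OF compact_polyomino_hull[OF assms(1)]]
    by (auto intro!: sets.finite_UN simp: UN_subset_iff)
qed

lemma polyomino_area_lower:
  "polyomino n P \<Longrightarrow> real n \<le> measure lebesgue (polyomino_hull P)"
  using measure_hull_ge[of P "{}"] by (simp add: polyomino_def)

text \<open>Integrality of the doubled area needs the hull as one of finitely many lattice
  points.\<close>

lemma hull_lattice_points:
  "polyomino_hull P = convex hull (\<Union>(i, j)\<in>P. {of_int i, of_int i + 1} \<times> {of_int j, of_int j + 1})"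
proof -
  have sq: "unit_square (i, j) = convex hull ({of_int i, of_int i + 1} \<times> {of_int j, of_int j + 1})" for i j
  proof -
    have "convex hull {x, x + 1} = {x..x + 1}" for x :: real
      by (simp add: closed_segment_eq_real_ivl flip: segment_convex_hull)
    then show ?thesis unfolding unit_square_eq convex_hull_Times by simp
  qed
  let ?V = "\<Union>(i, j)\<in>P. {real_of_int i, of_int i + 1} \<times> {real_of_int j, of_int j + 1}"
  have "?V \<subseteq> \<Union>(unit_square ` P)" by (auto simp: unit_square_eq)
  moreover have "unit_square c \<subseteq> convex hull ?V" if "c \<in> P" for c
  proof -
    obtain i j where c: "c = (i, j)" by (cases c)
    show ?thesis unfolding c sq by (rule hull_mono) (use that c in blast)
  qed
  ultimately show ?thesis
    unfolding polyomino_hull_def by (intro equalityI hull_mono hull_minimal) auto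
qed

lemma polyomino_area_half_integral:
  assumes "finite P"
  shows "2 * measure lebesgue (polyomino_hull P) \<in> \<int>"
  unfolding hull_lattice_points using assms by (intro measure_lattice_hull) auto

text \<open>A 2-by-2 block that lacks exactly the cell diagonally opposite p; the signs s and t
  encode the four orientations.\<close>

definition notch :: "cell set \<Rightarrow> cell \<Rightarrow> int \<Rightarrow> int \<Rightarrow> bool" where
  "notch P p s t \<longleftrightarrow> \<bar>s\<bar> = 1 \<and> \<bar>t\<bar> = 1 \<and>
     p \<in> P \<and> p + (s, 0) \<in> P \<and> p + (0, t) \<in> P \<and> p + (s, t) \<notin> P"

lemma triangle_subset:
  assumes "convex C" "a \<in> C" "b \<in> C" "c \<in> C"
  shows "convex hull {a, b, c} \<subseteq> C"
  using assms by (intro hull_minimal) auto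

lemma abs_eq_1_cases: "\<bar>s\<bar> = 1 \<Longrightarrow> s = 1 \<or> s = - 1" for s :: int
  by linarith

lemma half_square_in_hull:
  assumes "\<bar>s\<bar> = 1" "\<bar>t\<bar> = 1" "p \<in> P" "p + (s, 0) \<in> P" "p + (0, t) \<in> P"
  obtains T where "compact T" "T \<subseteq> unit_square (p + (s, t)) \<inter> polyomino_hull P" "measure lebesgue T = 1 / 2"
proof -
  obtain i j where p: "p = (i, j)" by (cases p)
  \<comment> \<open>The fractions turn the signs into offsets 0 or 1: v is the lattice point common
    to the four cells of the block, and the triangle has its right angle there.\<close>
  define v :: "real \<times> real" where "v = (of_int i + (1 + of_int s) / 2, of_int j + (1 + of_int t) / 2)"
  let ?T = "convex hull {v, v + (of_int s, 0), v + (0, of_int t)}"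
  have st: "s = 1 \<or> s = - 1" "t = 1 \<or> t = - 1" using assms abs_eq_1_cases by auto
  have "v \<in> unit_square p" "v + (of_int s, 0) \<in> unit_square (p + (s, 0))"
    "v + (0, of_int t) \<in> unit_square (p + (0, t))"
    "v \<in> unit_square (p + (s, t))" "v + (of_int s, 0) \<in> unit_square (p + (s, t))"
    "v + (0, of_int t) \<in> unit_square (p + (s, t))"
    using st by (auto simp: p v_def unit_square_eq)
  then have "?T \<subseteq> unit_square (p + (s, t)) \<inter> polyomino_hull P"
    using assms unit_square_subset_hull[of _ P]
    by (intro triangle_subset convex_Int unit_square_props convex_polyomino_hull) blast+
  moreover have "measure lebesgue ?T = 1 / 2" using st by (auto simp: measure_triangle cross_def)
  moreover have "compact ?T" by (intro finite_imp_compact_convex_hull) auto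
  ultimately show ?thesis using that by blast
qed

text \<open>Here the column of p goes on past the missing cell. With v the centre of the block, the
  segment from v + (s, 0) to v + (0, 2 t) bounds a triangle with legs 1 and 1/2 in the cell beyond
  the missing one. This serves to show that filling a notch does not create another.\<close>

lemma quarter_square_in_hull_vertical:
  assumes "\<bar>s\<bar> = 1" "\<bar>t\<bar> = 1" "p \<in> P" "p + (s, 0) \<in> P" "p + (0, t) \<in> P" "p + (0, 2 * t) \<in> P"
  obtains T where "compact T" "T \<subseteq> unit_square (p + (s, 2 * t)) \<inter> polyomino_hull P" "measure lebesgue T = 1 / 4"
proof -
  obtain i j where p: "p = (i, j)" by (cases p)
  define v :: "real \<times> real" where "v = (of_int i + (1 + of_int s) / 2, of_int j + (1 + of_int t) / 2)"
  let ?w = "v + (of_int s / 2, of_int t)"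
  let ?T = "convex hull {v + (0, of_int t), v + (0, 2 * of_int t), ?w}"
  have st: "s = 1 \<or> s = - 1" "t = 1 \<or> t = - 1" using assms abs_eq_1_cases by auto
  have sq: "v + (of_int s, 0) \<in> unit_square (p + (s, 0))"
    "v + (0, of_int t) \<in> unit_square (p + (0, t))" "v + (0, 2 * of_int t) \<in> unit_square (p + (0, 2 * t))"
    "v + (0, of_int t) \<in> unit_square (p + (s, 2 * t))"
    "v + (0, 2 * of_int t) \<in> unit_square (p + (s, 2 * t))" "?w \<in> unit_square (p + (s, 2 * t))"
    using st by (auto simp: p v_def unit_square_eq)
  then have K: "v + (of_int s, 0) \<in> polyomino_hull P" "v + (0, of_int t) \<in> polyomino_hull P"
    "v + (0, 2 * of_int t) \<in> polyomino_hull P"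
    using assms unit_square_subset_hull by blast+
  have "?w = (1 / 2) *\<^sub>R (v + (of_int s, 0)) + (1 / 2) *\<^sub>R (v + (0, 2 * of_int t))"
    by (simp add: prod_eq_iff field_simps)
  then have "?w \<in> polyomino_hull P"
    using convexD[OF convex_polyomino_hull K(1,3), of "1 / 2" "1 / 2"] by simp
  then have "?T \<subseteq> unit_square (p + (s, 2 * t)) \<inter> polyomino_hull P"
    using sq K by (intro triangle_subset convex_Int unit_square_props convex_polyomino_hull) blast+
  moreover have "measure lebesgue ?T = 1 / 4" using st by (auto simp: measure_triangle cross_def)
  moreover have "compact ?T" by (intro finite_imp_compact_convex_hull) auto
  ultimately show ?thesis using that by blast
qed

lemma quarter_square_in_hull_horizontal:
  assumes "\<bar>s\<bar> = 1" "\<bar>t\<bar> = 1" "p \<in> P" "p + (s, 0) \<in> P" "p + (0, t) \<in> P" "p + (2 * s, 0) \<in> P"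
  obtains T where "compact T" "T \<subseteq> unit_square (p + (2 * s, t)) \<inter> polyomino_hull P" "measure lebesgue T = 1 / 4"
proof -
  obtain i j where p: "p = (i, j)" by (cases p)
  define v :: "real \<times> real" where "v = (of_int i + (1 + of_int s) / 2, of_int j + (1 + of_int t) / 2)"
  let ?w = "v + (of_int s, of_int t / 2)"
  let ?T = "convex hull {v + (of_int s, 0), v + (2 * of_int s, 0), ?w}"
  have st: "s = 1 \<or> s = - 1" "t = 1 \<or> t = - 1" using assms abs_eq_1_cases by auto
  have sq: "v + (0, of_int t) \<in> unit_square (p + (0, t))"
    "v + (of_int s, 0) \<in> unit_square (p + (s, 0))" "v + (2 * of_int s, 0) \<in> unit_square (p + (2 * s, 0))"
    "v + (of_int s, 0) \<in> unit_square (p + (2 * s, t))"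
    "v + (2 * of_int s, 0) \<in> unit_square (p + (2 * s, t))" "?w \<in> unit_square (p + (2 * s, t))"
    using st by (auto simp: p v_def unit_square_eq)
  then have K: "v + (0, of_int t) \<in> polyomino_hull P" "v + (of_int s, 0) \<in> polyomino_hull P"
    "v + (2 * of_int s, 0) \<in> polyomino_hull P"
    using assms unit_square_subset_hull by blast+
  have "?w = (1 / 2) *\<^sub>R (v + (0, of_int t)) + (1 / 2) *\<^sub>R (v + (2 * of_int s, 0))"
    by (simp add: prod_eq_iff field_simps)
  then have "?w \<in> polyomino_hull P"
    using convexD[OF convex_polyomino_hull K(1,3), of "1 / 2" "1 / 2"] by simp
  then have "?T \<subseteq> unit_square (p + (2 * s, t)) \<inter> polyomino_hull P"
    using sq K by (intro triangle_subset convex_Int unit_square_props convex_polyomino_hull) blast+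
  moreover have "measure lebesgue ?T = 1 / 4" using st by (auto simp: measure_triangle cross_def)
  moreover have "compact ?T" by (intro finite_imp_compact_convex_hull) auto
  ultimately show ?thesis using that by blast
qed

text \<open>Each z in the square is the midpoint of z + e and z - e, which lie in squares of
  P.\<close>

lemma unit_square_between:
  assumes "c + e \<in> P" "c - e \<in> P"
  shows "unit_square c \<subseteq> polyomino_hull P"
proof
  fix z assume z: "z \<in> unit_square c"
  let ?e = "(of_int (fst e), of_int (snd e)) :: real \<times> real"
  have "z + ?e \<in> unit_square (c + e)" "z - ?e \<in> unit_square (c - e)"
    using z by (cases c, cases e, cases z, auto simp: unit_square_eq)+
  then have "z + ?e \<in> polyomino_hull P" "z - ?e \<in> polyomino_hull P"
    using assms unit_square_subset_hull by blast+
  then have "(1 / 2) *\<^sub>R (z + ?e) + (1 / 2) *\<^sub>R (z - ?e) \<in> polyomino_hull P"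
    by (intro convexD[OF convex_polyomino_hull]) auto
  then show "z \<in> polyomino_hull P" by (simp add: algebra_simps flip: scaleR_add_left)
qed

text \<open>Beside a full stretch of a column, a single cell spreads up and down one 2-by-2 block at
  a time. Stated for a relation, it serves for rows too, with the coordinates exchanged.\<close>

lemma no_notch_fill:
  fixes R :: "int \<Rightarrow> int \<Rightarrow> bool"
  assumes closed: "\<And>x j s t. \<bar>s\<bar> = 1 \<Longrightarrow> \<bar>t\<bar> = 1 \<Longrightarrow> R x j \<Longrightarrow> R (x + s) j \<Longrightarrow> R x (j + t) \<Longrightarrow> R (x + s) (j + t)"
    and s: "\<bar>s\<bar> = 1" and col: "\<And>j. lo \<le> j \<Longrightarrow> j \<le> hi \<Longrightarrow> R x j"
    and j0: "R (x + s) j0" "lo \<le> j0" "j0 \<le> hi" and j: "lo \<le> j" "j \<le> hi"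
  shows "R (x + s) j"
proof (cases "j0 \<le> j")
  case True
  then show ?thesis using j(2)
  proof (induction j rule: int_ge_induct)
    case (step k)
    then show ?case using closed[of s 1 x k] s col[of k] col[of "k + 1"] j0 by auto
  qed (use j0 in auto)
next
  case False
  then have "j \<le> j0" by simp
  then show ?thesis using j(1)
  proof (induction j rule: int_le_induct)
    case (step k)
    then show ?case using closed[of s "-1" x k] s col[of k] col[of "k - 1"] j0 by auto
  qed (use j0 in auto)
qed

text \<open>Induction along a chain starting at c: the bounding box of c and the current cell stays
  in P. A step out of the box enlarges it by one row or column, which fills up from the new cell
  along the full row or column beside it.\<close>

lemma no_notch_box:
  assumes "edge_connected P" and no: "\<And>p s t. \<not> notch P p s t"
    and "c \<in> P" "d \<in> P" "i \<in> {min (fst c) (fst d)..max (fst c) (fst d)}"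
    "j \<in> {min (snd c) (snd d)..max (snd c) (snd d)}"
  shows "(i, j) \<in> P"
proof -
  have cl: "(x + s, j + t) \<in> P"
    if "\<bar>s\<bar> = 1" "\<bar>t\<bar> = 1" "(x, j) \<in> P" "(x + s, j) \<in> P" "(x, j + t) \<in> P" for x j s t
    using no[of "(x, j)" s t] that by (auto simp: notch_def)
  have "(c, d) \<in> {(x, y). x \<in> P \<and> y \<in> P \<and> edge_adjacent x y}\<^sup>*"
    using assms unfolding edge_connected_def by blast
  then have "\<forall>i j. i \<in> {min (fst c) (fst d)..max (fst c) (fst d)} \<longrightarrow>
    j \<in> {min (snd c) (snd d)..max (snd c) (snd d)} \<longrightarrow> (i, j) \<in> P"
  proof (induction rule: rtrancl_induct)
    case base
    then show ?case using assms by (auto simp: antisym)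
  next
    case (step d d')
    obtain c1 c2 d1 d2 e1 e2 where eq: "c = (c1, c2)" "d = (d1, d2)" "d' = (e1, e2)"
      by (cases c, cases d, cases d')
    have d': "(e1, e2) \<in> P" and adj: "edge_adjacent d d'" using step eq by auto
    have IH: "(i, j) \<in> P" if "min c1 d1 \<le> i" "i \<le> max c1 d1" "min c2 d2 \<le> j" "j \<le> max c2 d2" for i j
      using step.IH that by (auto simp: eq)
    show ?case
    proof (intro allI impI)
      fix i j assume "i \<in> {min (fst c) (fst d')..max (fst c) (fst d')}"
        "j \<in> {min (snd c) (snd d')..max (snd c) (snd d')}"
      then have ij: "min c1 e1 \<le> i" "i \<le> max c1 e1" "min c2 e2 \<le> j" "j \<le> max c2 e2" by (auto simp: eq)
      from adj consider s where "e1 = d1 + s" "e2 = d2" "\<bar>s\<bar> = 1" | t where "e1 = d1" "e2 = d2 + t" "\<bar>t\<bar> = 1"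
        unfolding edge_adjacent_def eq
        by (metis abs_minus_commute add.commute diff_add_cancel fst_conv snd_conv)
      then show "(i, j) \<in> P"
      proof cases
        case (1 s)
        show ?thesis
        proof (cases "min c1 d1 \<le> i \<and> i \<le> max c1 d1")
          case True
          then show ?thesis using ij 1 by (intro IH) auto
        next
          case False
          then have "i = d1 + s" using ij 1 by auto
          moreover have "(d1 + s, j) \<in> P"
          proof (rule no_notch_fill[of "\<lambda>x j. (x, j) \<in> P" s "min c2 d2" "max c2 d2" d1 d2 j])
            show "(d1, k) \<in> P" if "min c2 d2 \<le> k" "k \<le> max c2 d2" for k
              using that by (intro IH) auto
            show "(d1 + s, d2) \<in> P" using d' 1 by simp
            show "min c2 d2 \<le> j" "j \<le> max c2 d2" using ij 1 by simp_all
          qed (use 1 in \<open>auto intro: cl\<close>)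
          ultimately show ?thesis by simp
        qed
      next
        case (2 t)
        show ?thesis
        proof (cases "min c2 d2 \<le> j \<and> j \<le> max c2 d2")
          case True
          then show ?thesis using ij 2 by (intro IH) auto
        next
          case False
          then have "j = d2 + t" using ij 2 by auto
          moreover have "(i, d2 + t) \<in> P"
          proof (rule no_notch_fill[of "\<lambda>x j. (j, x) \<in> P" t "min c1 d1" "max c1 d1" d2 d1 i])
            show "(k, d2) \<in> P" if "min c1 d1 \<le> k" "k \<le> max c1 d1" for k
              using that by (intro IH) auto
            show "(d1, d2 + t) \<in> P" using d' 2 by simp
            show "min c1 d1 \<le> i" "i \<le> max c1 d1" using ij 2 by simp_all
          qed (use 2 in \<open>auto intro: cl\<close>)
          ultimately show ?thesis by simp
        qed
      qed
    qed
  qed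
  then show ?thesis using assms by blast
qed

lemma no_notch_rectangle:
  assumes "finite P" "P \<noteq> {}" "edge_connected P" "\<And>p s t. \<not> notch P p s t"
  obtains a b c d where "P = {a..b} \<times> {c..d}"
proof -
  note box = no_notch_box[OF assms(3,4)]
  obtain p q r u where pq: "p \<in> P" "q \<in> P" "r \<in> P" "u \<in> P"
    and ext: "\<And>x. x \<in> P \<Longrightarrow> fst p \<le> fst x \<and> fst x \<le> fst q \<and> snd r \<le> snd x \<and> snd x \<le> snd u"
  proof -
    obtain p where "p \<in> P" "\<forall>x\<in>P. fst p \<le> fst x"
      using arg_min_if_finite[OF assms(1,2), of fst] by (metis not_less)
    moreover obtain q where "q \<in> P" "\<forall>x\<in>P. - fst q \<le> - fst x"
      using arg_min_if_finite[OF assms(1,2), of "\<lambda>x. - fst x"] by (metis not_less)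
    moreover obtain r where "r \<in> P" "\<forall>x\<in>P. snd r \<le> snd x"
      using arg_min_if_finite[OF assms(1,2), of snd] by (metis not_less)
    moreover obtain u where "u \<in> P" "\<forall>x\<in>P. - snd u \<le> - snd x"
      using arg_min_if_finite[OF assms(1,2), of "\<lambda>x. - snd x"] by (metis not_less)
    ultimately show ?thesis by (intro that[of p q r u]) auto
  qed
  \<comment> \<open>The box of p and q reaches every column and the box of r and u every row. This
    gives two cells of P, one in column i and one in row j, and (i, j) is a corner of their bounding
    box.\<close>
  have sup: "(i, j) \<in> P" if "i \<in> {fst p..fst q}" "j \<in> {snd r..snd u}" for i j
  proof -
    have "(i, snd p) \<in> P" using pq that by (intro box[of p q i "snd p"]) auto
    moreover have "(fst r, j) \<in> P" using pq that by (intro box[of r u "fst r" j]) auto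
    ultimately show ?thesis by (rule box[of "(i, snd p)" "(fst r, j)"]) auto
  qed
  have "P = {fst p..fst q} \<times> {snd r..snd u}"
  proof (intro equalityI subsetI)
    fix x assume "x \<in> P"
    then show "x \<in> {fst p..fst q} \<times> {snd r..snd u}" using ext[of x] by (cases x) simp
  next
    fix x assume "x \<in> {fst p..fst q} \<times> {snd r..snd u}"
    then show "x \<in> P" using sup by (cases x) blast
  qed
  then show ?thesis using that by blast
qed

lemma measure_rectangle_hull_le:
  fixes a b c d :: int
  assumes "P = {a..b} \<times> {c..d}" "P \<noteq> {}"
  shows "measure lebesgue (polyomino_hull P) \<le> real (card P)"
proof -
  have ab: "a \<le> b" "c \<le> d" using assms by auto
  have sides: "measure lborel (cbox (real_of_int a) (of_int b + 1)) = real_of_int (b - a + 1)"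
    "measure lborel (cbox (real_of_int c) (of_int d + 1)) = real_of_int (d - c + 1)"
    using ab by auto
  have "polyomino_hull P \<subseteq> cbox (of_int a, of_int c) (of_int b + 1, of_int d + 1)"
    by (rule polyomino_hull_subset) (auto simp: assms(1) unit_square_eq)
  then have "measure lebesgue (polyomino_hull P) \<le>
      measure lebesgue (cbox (of_int a, of_int c) (of_int b + 1 :: real, of_int d + 1 :: real))"
    using compact_polyomino_hull[of P] assms(1) by (intro measure_mono_fmeasurable) (auto simp: fmeasurableD lmeasurable_compact)
  also have "\<dots> = measure lborel (cbox (real_of_int a) (of_int b + 1)) * measure lborel (cbox (real_of_int c) (of_int d + 1))"
    by (simp only: content_Pair measure_completion sets_lborel borel_closed closed_cbox)
  also have "\<dots> = real_of_int (b - a + 1) * real_of_int (d - c + 1)"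
    by (simp only: sides)
  also have "\<dots> = real (nat (b - a + 1)) * real (nat (d - c + 1))" using ab by simp
  also have "\<dots> = real (card P)" by (simp only: assms(1) card_cartesian_product card_atLeastAtMost_int of_nat_mult)
  finally show ?thesis .
qed

lemma edge_connected_Un:
  assumes "edge_connected A" "edge_connected B" "p \<in> A" "q \<in> B" "edge_adjacent p q"
  shows "edge_connected (A \<union> B)"
proof -
  let ?E = "{(x, y). x \<in> A \<union> B \<and> y \<in> A \<union> B \<and> edge_adjacent x y}"
  have sym: "edge_adjacent x y \<longleftrightarrow> edge_adjacent y x" for x y
    by (auto simp: edge_adjacent_def abs_minus_commute)
  have sub: "(x, y) \<in> ?E\<^sup>*" if "edge_connected C" "C \<subseteq> A \<union> B" "x \<in> C" "y \<in> C" for x y C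
  proof -
    have "(x, y) \<in> {(x, y). x \<in> C \<and> y \<in> C \<and> edge_adjacent x y}\<^sup>*"
      using that unfolding edge_connected_def by blast
    then show ?thesis by (rule rtrancl_mono[THEN subsetD, rotated]) (use that in auto)
  qed
  have "(p, q) \<in> ?E" "(q, p) \<in> ?E" using assms sym by auto
  then have pq: "(p, q) \<in> ?E\<^sup>*" "(q, p) \<in> ?E\<^sup>*" by blast+
  have to_p: "(x, p) \<in> ?E\<^sup>* \<and> (p, x) \<in> ?E\<^sup>*" if "x \<in> A \<union> B" for x
  proof (cases "x \<in> A")
    case True
    then show ?thesis using sub[OF assms(1)] assms(3) by auto
  next
    case False
    then have "(x, q) \<in> ?E\<^sup>*" "(q, x) \<in> ?E\<^sup>*" using sub[OF assms(2)] assms(4) that by auto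
    then show ?thesis using pq by (meson rtrancl_trans)
  qed
  show ?thesis unfolding edge_connected_def using to_p by (meson rtrancl_trans)
qed

lemma edge_connected_singleton: "edge_connected {c}"
  by (simp add: edge_connected_def)

text \<open>Half of the missing cell c uses up the surplus, so the hull meets every other missing
  cell in measure zero. A notch of \<open>insert c P\<close> is excluded according to the position
  of c in its block: few neighbours of c can lie in P, quarter triangles appear beside c, and a
  block without c yields a second half square. The final rectangle contains the diagonal neighbours
  p and c, so both sides are at least 2.\<close>

lemma area_half_excess_composite:
  assumes poly: "polyomino n P" "n \<ge> 1" and area: "measure lebesgue (polyomino_hull P) = real n + 1 / 2"
  shows "\<not> prime (n + 1)"
proof -
  have P: "finite P" "card P = n" "edge_connected P" "P \<noteq> {}" using poly by (auto simp: polyomino_def)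
  \<comment> \<open>A missing cell that is covered entirely would force area at least n + 1.\<close>
  have full: False if "unit_square c \<subseteq> polyomino_hull P" "c \<notin> P" for c
    using measure_hull_ge[OF P(1), of "{c}" unit_square] that area P(2)
    by (auto simp: unit_square_props measure_unit_square)
  obtain p s t where "notch P p s t"
  proof (rule ccontr)
    assume "\<not> thesis"
    then have "\<And>p s t. \<not> notch P p s t" using that by blast
    then obtain a b c d where "P = {a..b} \<times> {c..d}" using no_notch_rectangle[OF P(1,4,3)] by metis
    then show False using measure_rectangle_hull_le[OF _ P(4)] P(2) area by fastforce
  qed
  then have st: "\<bar>s\<bar> = 1" "\<bar>t\<bar> = 1" and in_P: "p \<in> P" "p + (s, 0) \<in> P" "p + (0, t) \<in> P"
    and out: "p + (s, t) \<notin> P" by (auto simp: notch_def)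
  define c where "c = p + (s, t)"
  have nc: "c - (s, 0) \<in> P" "c - (0, t) \<in> P" "c \<notin> P"
  proof -
    have "c - (s, 0) = p + (0, t)" "c - (0, t) = p + (s, 0)" by (simp_all add: c_def prod_eq_iff)
    then show "c - (s, 0) \<in> P" "c - (0, t) \<in> P" "c \<notin> P" using in_P out unfolding c_def by metis+
  qed
  obtain T where T: "compact T" "T \<subseteq> unit_square c \<inter> polyomino_hull P" "measure lebesgue T = 1 / 2"
    using half_square_in_hull[OF st in_P] c_def by metis
  have only_c: False if "d \<noteq> c" "d \<notin> P" "compact U" "U \<subseteq> unit_square d \<inter> polyomino_hull P"
    "measure lebesgue U > 0" for d U
  proof -
    have "real (card P) + (\<Sum>x\<in>{c, d}. measure lebesgue (if x = c then T else U)) \<le>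
        measure lebesgue (polyomino_hull P)"
      by (rule measure_hull_ge) (use that P T nc in auto)
    then show False using that T area P(2) by auto
  qed
  \<comment> \<open>A cell of P on the far side of c from a known neighbour would make the hull
    cover c.\<close>
  have across: "c + (s, 0) \<notin> P" "c + (0, t) \<notin> P"
    using full[OF unit_square_between[of c "(s, 0)" P]] full[OF unit_square_between[of c "(0, t)" P]] nc
    by blast+
  have opp: "\<sigma> = s \<or> \<sigma> = - s" if "\<bar>\<sigma>\<bar> = 1" for \<sigma> using that st by linarith
  have opp': "\<sigma> = t \<or> \<sigma> = - t" if "\<bar>\<sigma>\<bar> = 1" for \<sigma> using that st by linarith
  have "\<not> notch (insert c P) q \<sigma> \<tau>" for q \<sigma> \<tau>
  proof
    assume "notch (insert c P) q \<sigma> \<tau>"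
    then have \<sigma>\<tau>: "\<bar>\<sigma>\<bar> = 1" "\<bar>\<tau>\<bar> = 1" and q: "q \<in> insert c P" "q + (\<sigma>, 0) \<in> insert c P"
      "q + (0, \<tau>) \<in> insert c P" "q + (\<sigma>, \<tau>) \<noteq> c" "q + (\<sigma>, \<tau>) \<notin> P" by (auto simp: notch_def)
    have ne: "x + (\<sigma>, 0) \<noteq> x" "x + (0, \<tau>) \<noteq> x" "x - (\<sigma>, 0) \<noteq> x" "x - (0, \<tau>) \<noteq> x"
      "x - (\<sigma>, 0) + (0, \<tau>) \<noteq> x" "x - (0, \<tau>) + (\<sigma>, 0) \<noteq> x" for x
      using \<sigma>\<tau> by (auto simp: prod_eq_iff)
    consider "q = c" | "q + (\<sigma>, 0) = c" | "q + (0, \<tau>) = c" | "q \<in> P" "q + (\<sigma>, 0) \<in> P" "q + (0, \<tau>) \<in> P"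
      using q by blast
    then show False
    proof cases
      case 1
      \<comment> \<open>Only c - (s, 0) and c - (0, t) are neighbours of c in P, so the missing cell
        of the block would be p.\<close>
      then have "c + (\<sigma>, 0) \<in> P" "c + (0, \<tau>) \<in> P" using q(2,3) ne[of c] unfolding 1 by blast+
      then have "\<sigma> = - s" "\<tau> = - t" using across opp[OF \<sigma>\<tau>(1)] opp'[OF \<sigma>\<tau>(2)] by auto
      then have "q + (\<sigma>, \<tau>) = p" using 1 by (simp add: c_def prod_eq_iff)
      then show False using q in_P by simp
    next
      case 2
      then have qc: "q = c - (\<sigma>, 0)" by (metis add_diff_cancel_right')
      have qP: "q \<in> P" "q + (0, \<tau>) \<in> P" using q(1,3) ne[of c] unfolding qc by blast+
      have "\<sigma> = s"
      proof (rule ccontr)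
        assume "\<sigma> \<noteq> s"
        then have "\<sigma> = - s" using opp \<sigma>\<tau> by blast
        then have "q = c + (s, 0)" by (simp add: qc prod_eq_iff)
        then show False using qP across by simp
      qed
      then have qp: "q = p + (0, t)" by (simp add: qc c_def prod_eq_iff)
      \<comment> \<open>Either the block points away from p and its missing cell contains a quarter
        triangle, or it points back and its supposedly missing cell is p + (s, 0).\<close>
      from opp'[OF \<sigma>\<tau>(2)] show False
      proof
        assume "\<tau> = t"
        then have "q + (0, \<tau>) = p + (0, 2 * t)" "q + (\<sigma>, \<tau>) = p + (s, 2 * t)"
          using \<open>\<sigma> = s\<close> by (auto simp: qp prod_eq_iff)
        moreover from this obtain U where "compact U" "U \<subseteq> unit_square (p + (s, 2 * t)) \<inter> polyomino_hull P"
          "measure lebesgue U = 1 / 4"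
          using quarter_square_in_hull_vertical[OF st in_P] qP by metis
        ultimately show False using only_c[of "p + (s, 2 * t)" U] q by simp
      next
        assume "\<tau> = - t"
        then have "q + (\<sigma>, \<tau>) = p + (s, 0)" using \<open>\<sigma> = s\<close> by (auto simp: qp prod_eq_iff)
        then show False using q in_P by simp
      qed
    next
      case 3
      then have qc: "q = c - (0, \<tau>)" by (metis add_diff_cancel_right')
      have qP: "q \<in> P" "q + (\<sigma>, 0) \<in> P" using q(1,2) ne[of c] unfolding qc by blast+
      have "\<tau> = t"
      proof (rule ccontr)
        assume "\<tau> \<noteq> t"
        then have "\<tau> = - t" using opp' \<sigma>\<tau> by blast
        then have "q = c + (0, t)" by (simp add: qc prod_eq_iff)
        then show False using qP across by simp
      qed
      then have qp: "q = p + (s, 0)" by (simp add: qc c_def prod_eq_iff)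
      from opp[OF \<sigma>\<tau>(1)] show False
      proof
        assume "\<sigma> = s"
        then have "q + (\<sigma>, 0) = p + (2 * s, 0)" "q + (\<sigma>, \<tau>) = p + (2 * s, t)"
          using \<open>\<tau> = t\<close> by (auto simp: qp prod_eq_iff)
        moreover from this obtain U where "compact U" "U \<subseteq> unit_square (p + (2 * s, t)) \<inter> polyomino_hull P"
          "measure lebesgue U = 1 / 4"
          using quarter_square_in_hull_horizontal[OF st in_P] qP by metis
        ultimately show False using only_c[of "p + (2 * s, t)" U] q by simp
      next
        assume "\<sigma> = - s"
        then have "q + (\<sigma>, \<tau>) = p + (0, t)" using \<open>\<tau> = t\<close> by (auto simp: qp prod_eq_iff)
        then show False using q in_P by simp
      qed
    next
      case 4
      obtain U where "compact U" "U \<subseteq> unit_square (q + (\<sigma>, \<tau>)) \<inter> polyomino_hull P"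
        "measure lebesgue U = 1 / 2"
        using half_square_in_hull[OF \<sigma>\<tau> 4] by metis
      then show False using only_c[of "q + (\<sigma>, \<tau>)" U] q by simp
    qed
  qed
  moreover have "edge_connected (P \<union> {c})"
  proof (rule edge_connected_Un[OF P(3) edge_connected_singleton in_P(2)])
    show "c \<in> {c}" by simp
    show "edge_adjacent (p + (s, 0)) c" using st by (cases p) (simp add: c_def edge_adjacent_def)
  qed
  then have "edge_connected (insert c P)" by simp
  ultimately obtain a b d e where rect: "insert c P = {a..b} \<times> {d..e}"
    using no_notch_rectangle[of "insert c P"] P(1) by (metis finite_insert insert_not_empty)
  have "p \<in> insert c P" "p + (s, t) \<in> insert c P" using in_P c_def by auto
  then have "a < b" "d < e" using st unfolding rect by (cases p, auto)+
  then have len: "2 \<le> nat (b - a + 1)" "2 \<le> nat (e - d + 1)" by linarith+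
  have "n + 1 = card (insert c P)" using P nc by simp
  also have "\<dots> = nat (b - a + 1) * nat (e - d + 1)"
    by (simp only: rect card_cartesian_product card_atLeastAtMost_int)
  finally have eq: "n + 1 = nat (b - a + 1) * nat (e - d + 1)" .
  show ?thesis
  proof
    assume "prime (n + 1)"
    then have "nat (b - a + 1) = 1 \<or> nat (e - d + 1) = 1" unfolding eq by (rule prime_product)
    then show False using len by linarith
  qed
qed

section \<open>Constructions\<close>

text \<open>The hexagon with vertices \<open>(0, v)\<close>, \<open>(1, 0)\<close>, \<open>(b, 0)\<close>, \<open>(b, w)\<close>, \<open>(e, a)\<close>, \<open>(0, a)\<close>,
  possibly degenerate; all polyominoes constructed below have a hull of this form.\<close>

definition hexagon :: "real \<Rightarrow> real \<Rightarrow> real \<Rightarrow> real \<Rightarrow> real \<Rightarrow> (real \<times> real) set" where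
  "hexagon a b v w e = {(x, y). 0 \<le> x \<and> x \<le> b \<and> 0 \<le> y \<and> y \<le> a \<and>
     v * (1 - x) \<le> y \<and> (y - a) * (b - e) \<le> (w - a) * (x - e)}"

lemma convex_halfplane: "convex {(x, y). p * x + q * y \<le> (r :: real)}"
proof -
  have "{(x, y). p * x + q * y \<le> r} = {z. (p, q) \<bullet> z \<le> r}" by auto
  then show ?thesis using convex_halfspace_le by metis
qed

lemma closed_halfplane: "closed {(x, y). p * x + q * y \<le> (r :: real)}"
proof -
  have "{(x, y). p * x + q * y \<le> r} = {z. (p, q) \<bullet> z \<le> r}" by auto
  then show ?thesis using closed_halfspace_le by metis
qed

lemma hexagon_halfplanes:
  "hexagon a b v w e = cbox (0, 0) (b, a) \<inter> {(x, y). (- v) * x + (- 1) * y \<le> - v} \<inter>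
     {(x, y). (a - w) * x + (b - e) * y \<le> a * (b - e) + (a - w) * e}"
  by (auto simp: hexagon_def algebra_simps)

lemma convex_hexagon: "convex (hexagon a b v w e)"
  unfolding hexagon_halfplanes by (intro convex_Int convex_box convex_halfplane)

lemma compact_hexagon: "compact (hexagon a b v w e)"
  unfolding hexagon_halfplanes
  by (intro compact_Int_closed compact_cbox closed_halfplane)

definition hex_lower :: "real \<Rightarrow> real \<Rightarrow> real" where
  "hex_lower v x = (if x \<le> 1 then v * (1 - x) else 0)"

definition hex_upper :: "real \<Rightarrow> real \<Rightarrow> real \<Rightarrow> real \<Rightarrow> real \<Rightarrow> real" where
  "hex_upper a b w e x = (if x \<le> e then a else a - (a - w) * ((x - e) / (b - e)))"

text \<open>For x > e the slanted constraint can be divided by b - e > 0. If e = b, no such x occurs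
  and the constraint is vacuous, so the zero denominator in \<open>hex_upper\<close> does no
  harm.\<close>

lemma hexagon_slice:
  assumes "0 \<le> v" "v \<le> a" "0 \<le> w" "w \<le> a" "1 \<le> e" "e \<le> b"
  shows "(x, y) \<in> hexagon a b v w e \<longleftrightarrow> 0 \<le> x \<and> x \<le> b \<and> hex_lower v x \<le> y \<and> y \<le> hex_upper a b w e x"
proof (cases "0 \<le> x \<and> x \<le> b")
  case True
  have low: "0 \<le> y \<and> v * (1 - x) \<le> y \<longleftrightarrow> hex_lower v x \<le> y"
  proof (cases "x \<le> 1")
    case True
    then have "0 \<le> v * (1 - x)" using assms by simp
    then show ?thesis using True by (auto simp: hex_lower_def)
  next
    case False
    then have "v * (1 - x) \<le> 0" using assms by (simp add: mult_nonneg_nonpos)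
    then show ?thesis using False by (auto simp: hex_lower_def)
  qed
  have up: "y \<le> a \<and> (y - a) * (b - e) \<le> (w - a) * (x - e) \<longleftrightarrow> y \<le> hex_upper a b w e x"
  proof (cases "x \<le> e")
    case True
    have "(y - a) * (b - e) \<le> (w - a) * (x - e)" if "y \<le> a"
    proof -
      have "(y - a) * (b - e) \<le> 0" using that assms by (simp add: mult_nonpos_nonneg)
      also have "0 \<le> (w - a) * (x - e)" using True assms by (simp add: mult_nonpos_nonpos)
      finally show ?thesis .
    qed
    then show ?thesis using True by (auto simp: hex_upper_def)
  next
    case False
    then have be: "0 < b - e" using \<open>0 \<le> x \<and> x \<le> b\<close> by linarith
    define u where "u = (x - e) / (b - e)"
    have u: "x - e = u * (b - e)" "0 \<le> u" using be False by (auto simp: u_def)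
    have "(y - a) * (b - e) \<le> (w - a) * (x - e) \<longleftrightarrow> (y - a) * (b - e) \<le> ((w - a) * u) * (b - e)"
      by (simp only: u mult.assoc)
    also have "\<dots> \<longleftrightarrow> y \<le> a - (a - w) * u"
      using be by (simp add: mult_le_cancel_right) (auto simp: algebra_simps)
    finally have "(y - a) * (b - e) \<le> (w - a) * (x - e) \<longleftrightarrow> y \<le> a - (a - w) * u" .
    moreover have "0 \<le> (a - w) * u" using assms u by simp
    ultimately show ?thesis using False by (auto simp: hex_upper_def simp flip: u_def)
  qed
  show ?thesis unfolding hexagon_def using True low up by auto
qed (auto simp: hexagon_def)

lemma hex_lower_le_upper:
  assumes "0 \<le> v" "v \<le> a" "0 \<le> w" "w \<le> a" "1 \<le> e" "e \<le> b" "0 \<le> x" "x \<le> b"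
  shows "hex_lower v x \<le> hex_upper a b w e x"
proof (cases "x \<le> e")
  case True
  have "v * (1 - x) \<le> v" using assms by (simp add: mult_left_le)
  then show ?thesis using assms True by (auto simp: hex_lower_def hex_upper_def)
next
  case False
  then have "0 \<le> (x - e) / (b - e)" "(x - e) / (b - e) \<le> 1" using assms by (auto simp: divide_le_eq_1)
  then have "(a - w) * ((x - e) / (b - e)) \<le> a - w" using assms by (intro mult_left_le) auto
  then show ?thesis using assms False by (auto simp: hex_lower_def hex_upper_def)
qed

lemma has_integral_hex_lower:
  assumes "1 \<le> b"
  shows "(hex_lower v has_integral v / 2) {0..b}"
proof -
  have "((\<lambda>x. v + (- v) * x) has_integral (1 - 0) * (v + (- v) * (0 + 1) / 2)) {0..1}"
    by (intro has_integral_affine) simp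
  then have "(hex_lower v has_integral (1 - 0) * (v + (- v) * (0 + 1) / 2)) {0..1}"
    by (rule has_integral_eq[rotated]) (auto simp: hex_lower_def algebra_simps)
  moreover have "((\<lambda>x. 0) has_integral 0) {1..b}" by simp
  then have "(hex_lower v has_integral 0) {1..b}"
    by (rule has_integral_eq[rotated]) (auto simp: hex_lower_def)
  ultimately show ?thesis using has_integral_combine[of 0 1 b] assms by fastforce
qed

lemma has_integral_hex_upper:
  assumes "1 \<le> e" "e \<le> b"
  shows "(hex_upper a b w e has_integral a * b - (b - e) * (a - w) / 2) {0..b}"
proof -
  have 1: "((\<lambda>x. a) has_integral a * e) {0..e}"
    using has_integral_const_real[of a 0 e] assms by (simp add: mult.commute)
  then have 1: "(hex_upper a b w e has_integral a * e) {0..e}"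
    by (rule has_integral_eq[rotated]) (auto simp: hex_upper_def)
  have 2: "(hex_upper a b w e has_integral (b - e) * (a + w) / 2) {e..b}"
  proof (cases "e = b")
    case False
    define c where "c = (a - w) / (b - e)"
    have c: "c * (b - e) = a - w" using False by (simp add: c_def)
    have "((\<lambda>x. (a + c * e) + (- c) * x) has_integral (b - e) * ((a + c * e) + (- c) * (e + b) / 2)) {e..b}"
      using assms by (intro has_integral_affine)
    then have "(hex_upper a b w e has_integral (b - e) * ((a + c * e) + (- c) * (e + b) / 2)) {e..b}"
    proof (rule has_integral_eq[rotated])
      fix x assume "x \<in> {e..b}"
      then have "hex_upper a b w e x = a - c * (x - e)" by (auto simp: hex_upper_def c_def)
      then show "(a + c * e) + (- c) * x = hex_upper a b w e x" by (simp add: algebra_simps)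
    qed
    moreover have "(b - e) * ((a + c * e) + (- c) * (e + b) / 2) = (b - e) * (a + w) / 2"
    proof -
      have "(a + c * e) + (- c) * (e + b) / 2 = (a + w) / 2" using c by (simp add: field_simps)
      then show ?thesis by (simp only: times_divide_eq_right)
    qed
    ultimately show ?thesis by (simp only:)
  qed (auto intro: has_integral_refl)
  have "(hex_upper a b w e has_integral a * e + (b - e) * (a + w) / 2) {0..b}"
    using assms by (intro has_integral_combine[OF _ _ 1 2]) auto
  moreover have "a * e + (b - e) * (a + w) / 2 = a * b - (b - e) * (a - w) / 2"
    by (simp add: field_simps)
  ultimately show ?thesis by simp
qed

text \<open>The rectangle with sides b and a loses right triangles with legs 1, v and b - e, a - w;
  as e \<ge> 1, their ranges of x share at most an endpoint.\<close>

lemma measure_hexagon: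
  assumes "0 \<le> v" "v \<le> a" "0 \<le> w" "w \<le> a" "1 \<le> e" "e \<le> b"
  shows "measure lebesgue (hexagon a b v w e) = a * b - v / 2 - (b - e) * (a - w) / 2"
proof (rule measure_slices[OF compact_hexagon])
  let ?g = "\<lambda>x. if x \<in> {0..b} then hex_upper a b w e x - hex_lower v x else 0"
  show "0 \<le> ?g x" for x using hex_lower_le_upper[OF assms] by auto
  show "?g \<in> borel_measurable borel" unfolding hex_upper_def hex_lower_def by measurable
  show "emeasure lborel (Pair x -` hexagon a b v w e) = ennreal (?g x)" for x
  proof (cases "x \<in> {0..b}")
    case True
    then have "Pair x -` hexagon a b v w e = {hex_lower v x..hex_upper a b w e x}"
      using hexagon_slice[OF assms] by auto
    then show ?thesis using True hex_lower_le_upper[OF assms] by simp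
  next
    case False
    then have "Pair x -` hexagon a b v w e = {}" using hexagon_slice[OF assms] by auto
    then show ?thesis using False by (simp del: atLeastAtMost_iff)
  qed
  have "((\<lambda>x. hex_upper a b w e x - hex_lower v x) has_integral
      a * b - (b - e) * (a - w) / 2 - v / 2) {0..b}"
    using assms by (intro has_integral_diff has_integral_hex_upper has_integral_hex_lower) auto
  then show "(?g has_integral a * b - v / 2 - (b - e) * (a - w) / 2) UNIV"
    unfolding has_integral_restrict_UNIV by (simp add: algebra_simps)
qed

lemma convex_pairD:
  fixes H :: "(real \<times> real) set"
  assumes "convex H" "(x1, y1) \<in> H" "(x2, y2) \<in> H" "0 \<le> u" "u \<le> 1"
  shows "(x1 + u * (x2 - x1), y1 + u * (y2 - y1)) \<in> H"
  using convexD[OF assms(1-3), of "1 - u" u] assms(4,5) by (simp add: algebra_simps)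

text \<open>On each vertical line both ends of the slice lie on segments between the given
  vertices.\<close>

lemma hexagon_subset_convex:
  assumes "0 \<le> v" "v \<le> a" "0 \<le> w" "w \<le> a" "1 \<le> e" "e \<le> b" and H: "convex H"
    and V: "(0, v) \<in> H" "(0, a) \<in> H" "(1, 0) \<in> H" "(e, a) \<in> H" "(b, 0) \<in> H" "(b, w) \<in> H"
  shows "hexagon a b v w e \<subseteq> H"
proof
  fix z assume z: "z \<in> hexagon a b v w e"
  obtain x y where xy: "z = (x, y)" by (cases z)
  have x: "0 \<le> x" "x \<le> b" and y: "hex_lower v x \<le> y" "y \<le> hex_upper a b w e x"
    using z hexagon_slice[OF assms(1-6)] by (auto simp: xy)
  have lower: "(x, hex_lower v x) \<in> H"
  proof (cases "x \<le> 1")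
    case True
    then show ?thesis using convex_pairD[OF H V(1,3), of x] x by (simp add: hex_lower_def algebra_simps)
  next
    case False
    then have "1 + (x - 1) / (b - 1) * (b - 1) = x" using x by simp
    then show ?thesis using convex_pairD[OF H V(3,5), of "(x - 1) / (b - 1)"] x False
      by (simp add: hex_lower_def)
  qed
  have upper: "(x, hex_upper a b w e x) \<in> H"
  proof (cases "x \<le> e")
    case True
    then show ?thesis using convex_pairD[OF H V(2,4), of "x / e"] x assms by (simp add: hex_upper_def)
  next
    case False
    define u where "u = (x - e) / (b - e)"
    have "e + u * (b - e) = x" using False x by (simp add: u_def)
    moreover have "a + u * (w - a) = hex_upper a b w e x"
      using False by (simp add: hex_upper_def algebra_simps flip: u_def)
    moreover have "0 \<le> u" "u \<le> 1" using False x by (auto simp: u_def divide_le_eq_1)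
    ultimately show ?thesis using convex_pairD[OF H V(4,6), of u] by simp
  qed
  show "z \<in> H"
  proof (cases "hex_lower v x = hex_upper a b w e x")
    case True
    then show ?thesis using lower y by (simp add: xy)
  next
    case False
    let ?d = "hex_upper a b w e x - hex_lower v x"
    have "0 < ?d" using False y by simp
    then have "hex_lower v x + (y - hex_lower v x) / ?d * ?d = y" by simp
    then show ?thesis
      using convex_pairD[OF H lower upper, of "(y - hex_lower v x) / ?d"] y \<open>0 < ?d\<close> by (simp add: xy)
  qed
qed

text \<open>The slanted condition on a cell is the one for its upper right corner (i + 1, j + 1),
  the worst point of the square because w - a \<le> 0 \<le> b - e. Each vertex of the hexagon is a
  corner of a cell listed in \<open>V\<close>.\<close>

lemma polyomino_hull_hexagon:
  fixes a b v w e :: int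
  assumes par: "0 \<le> v" "v \<le> a" "1 \<le> w" "w \<le> a" "1 \<le> e" "e \<le> b"
    and cells: "\<And>i j. (i, j) \<in> P \<Longrightarrow> 0 \<le> i \<and> i < b \<and> 0 \<le> j \<and> j < a \<and> (i = 0 \<longrightarrow> v \<le> j) \<and>
      (j + 1 - a) * (b - e) \<le> (w - a) * (i + 1 - e)"
    and V: "(0, v) \<in> P" "(0, a - 1) \<in> P" "(0, 0) \<in> P \<or> (1, 0) \<in> P" "(e - 1, a - 1) \<in> P"
      "(b - 1, 0) \<in> P" "(b - 1, w - 1) \<in> P"
  shows "polyomino_hull P = hexagon a b v w e"
proof
  show "polyomino_hull P \<subseteq> hexagon a b v w e"
  proof (rule polyomino_hull_subset[OF convex_hexagon])
    fix c assume c: "c \<in> P"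
    obtain i j where ij: "c = (i, j)" by (cases c)
    show "unit_square c \<subseteq> hexagon a b v w e"
    proof
      fix z assume z: "z \<in> unit_square c"
      obtain x y where xy: "z = (x, y)" by (cases z)
      have x: "of_int i \<le> x" "x \<le> of_int i + 1" and y: "of_int j \<le> y" "y \<le> of_int j + 1"
        using z by (auto simp: ij xy unit_square_eq)
      note c' = cells[OF c[unfolded ij]]
      have "real_of_int i + 1 \<le> of_int b" "real_of_int j + 1 \<le> of_int a" "0 \<le> real_of_int i" "0 \<le> real_of_int j"
        using c' by linarith+
      then have bounds: "0 \<le> x" "x \<le> b" "0 \<le> y" "y \<le> a" using x y by linarith+
      have "real_of_int v * (1 - x) \<le> y"
      proof (cases "i = 0")
        case True
        have "real_of_int v * (1 - x) \<le> real_of_int v" using bounds par by (simp add: mult_left_le)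
        also have "\<dots> \<le> real_of_int j" using c' True by simp
        finally show ?thesis using y by simp
      next
        case False
        then have "1 \<le> real_of_int i" using c' by simp
        then have "real_of_int v * (1 - x) \<le> 0" using x par by (simp add: mult_nonneg_nonpos)
        then show ?thesis using bounds by simp
      qed
      moreover have "(y - of_int a) * (of_int b - of_int e) \<le> (of_int w - of_int a) * (x - of_int e)"
      proof -
        have "(y - of_int a) * (of_int b - of_int e) \<le> (of_int j + 1 - of_int a) * (of_int b - of_int e)"
          using y par by (intro mult_right_mono) auto
        also have "\<dots> = of_int ((j + 1 - a) * (b - e))" by simp
        also have "\<dots> \<le> real_of_int ((w - a) * (i + 1 - e))" using c' by linarith
        also have "\<dots> = (of_int w - of_int a) * (of_int i + 1 - of_int e)" by simp
        also have "\<dots> \<le> (of_int w - of_int a) * (x - of_int e)" using x par by (intro mult_left_mono_neg) auto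
        finally show ?thesis .
      qed
      ultimately show "z \<in> hexagon a b v w e" using bounds by (simp add: hexagon_def xy)
    qed
  qed
next
  have sq: "z \<in> polyomino_hull P" if "c \<in> P" "z \<in> unit_square c" for z c
    using that unit_square_subset_hull by blast
  show "hexagon a b v w e \<subseteq> polyomino_hull P"
  proof (rule hexagon_subset_convex[OF _ _ _ _ _ _ convex_polyomino_hull])
    show "(0, real_of_int v) \<in> polyomino_hull P" by (rule sq[OF V(1)]) (simp add: unit_square_eq)
    show "(0, real_of_int a) \<in> polyomino_hull P" by (rule sq[OF V(2)]) (simp add: unit_square_eq)
    \<comment> \<open>The vertex is the lower right corner of (0, 0) or the lower left corner of (1,
      0); the first cell is absent if v > 0.\<close>
    show "(1, 0) \<in> polyomino_hull P"
      using sq[of "(0, 0)" "(1, 0)"] sq[of "(1, 0)" "(1, 0)"] V(3) by (auto simp: unit_square_eq)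
    show "(real_of_int e, real_of_int a) \<in> polyomino_hull P" by (rule sq[OF V(4)]) (simp add: unit_square_eq)
    show "(real_of_int b, 0) \<in> polyomino_hull P" by (rule sq[OF V(5)]) (simp add: unit_square_eq)
    show "(real_of_int b, real_of_int w) \<in> polyomino_hull P" by (rule sq[OF V(6)]) (simp add: unit_square_eq)
  qed (use par in auto)
qed

definition realizable :: "nat \<Rightarrow> nat \<Rightarrow> bool" where
  "realizable n m \<longleftrightarrow> (\<exists>P. polyomino n P \<and> measure lebesgue (polyomino_hull P) = real n + real m / 2)"

text \<open>The last condition is the area formula doubled, which leaves only integer arithmetic to
  each construction.\<close>

lemma realizable_hexagon:
  fixes a b v w e :: int
  assumes "finite P" "card P = n" "edge_connected P"
    and "0 \<le> v" "v \<le> a" "1 \<le> w" "w \<le> a" "1 \<le> e" "e \<le> b"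
    and "\<And>i j. (i, j) \<in> P \<Longrightarrow> 0 \<le> i \<and> i < b \<and> 0 \<le> j \<and> j < a \<and> (i = 0 \<longrightarrow> v \<le> j) \<and>
      (j + 1 - a) * (b - e) \<le> (w - a) * (i + 1 - e)"
    and "(0, v) \<in> P" "(0, a - 1) \<in> P" "(0, 0) \<in> P \<or> (1, 0) \<in> P" "(e - 1, a - 1) \<in> P"
      "(b - 1, 0) \<in> P" "(b - 1, w - 1) \<in> P"
    and area: "2 * a * b - v - (b - e) * (a - w) = 2 * int n + int m"
  shows "realizable n m"
proof -
  have "measure lebesgue (polyomino_hull P) = of_int a * of_int b - of_int v / 2 -
      (of_int b - of_int e) * (of_int a - of_int w) / 2"
    using assms by (subst polyomino_hull_hexagon[OF assms(4-16)]) (auto intro!: measure_hexagon)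
  also have "\<dots> = real_of_int (2 * a * b - v - (b - e) * (a - w)) / 2" by (simp add: field_simps)
  also have "\<dots> = real n + real m / 2" unfolding area by simp
  finally show ?thesis using assms(1-3) unfolding realizable_def polyomino_def by blast
qed

lemma edge_connected_column: "edge_connected ({i} \<times> {j..l})" for i j l :: int
proof (cases "j \<le> l")
  case True
  then show ?thesis
  proof (induction l rule: int_ge_induct)
    case base
    then show ?case using edge_connected_singleton[of "(i, j)"] by simp
  next
    case (step l)
    have "{i} \<times> {j..l + 1} = ({i} \<times> {j..l}) \<union> {(i, l + 1)}" using step by auto
    moreover have "edge_connected \<dots>"
      using step by (intro edge_connected_Un[of _ _ "(i, l)" "(i, l + 1)"] edge_connected_singleton)
        (auto simp: edge_adjacent_def)
    ultimately show ?case by simp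
  qed
qed (simp add: edge_connected_def)

lemma edge_connected_rectangle: "edge_connected ({i..k} \<times> {j..l})" for i j k l :: int
proof (cases "i \<le> k \<and> j \<le> l")
  case True
  then have "i \<le> k" "j \<le> l" by auto
  from this(1) show ?thesis
  proof (induction k rule: int_ge_induct)
    case base
    then show ?case using edge_connected_column[of i j l] by simp
  next
    case (step k)
    have "{i..k + 1} \<times> {j..l} = ({i..k} \<times> {j..l}) \<union> ({k + 1} \<times> {j..l})" using step by auto
    moreover have "edge_connected \<dots>"
      using step \<open>j \<le> l\<close> by (intro edge_connected_Un[of _ _ "(k, j)" "(k + 1, j)"] edge_connected_column)
        (auto simp: edge_adjacent_def)
    ultimately show ?case by simp
  qed
qed (auto simp: edge_connected_def)

section \<open>Excess zero, excess one and small excesses\<close>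

lemma realizable_line:
  assumes "1 \<le> n"
  shows "realizable n 0"
  by (rule realizable_hexagon[where P = "{0} \<times> {0..int n - 1}" and a = "int n" and b = 1 and v = 0
        and w = "int n" and e = 1])
    (use assms edge_connected_column in auto)

text \<open>Removing a corner cell cuts only a triangle of area 1/2 off the hull, and a b - 1/2 = n
  + 1/2.\<close>

lemma realizable_rectangle_minus_corner:
  assumes "2 \<le> a" "2 \<le> b"
  shows "realizable (a * b - 1) 1"
proof -
  let ?A = "{0 :: int} \<times> {1..int a - 1}" and ?B = "{1..int b - 1} \<times> {0..int a - 1}"
  have "card (?A \<union> ?B) = card ?A + card ?B" by (intro card_Un_disjoint) auto
  also have "\<dots> = (a - 1) + (b - 1) * a"
    using assms by (simp add: card_cartesian_product nat_diff_distrib)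
  also have "\<dots> = a * b - 1" using assms by (cases b) (auto simp: algebra_simps)
  finally have card: "card (?A \<union> ?B) = a * b - 1" .
  have conn: "edge_connected (?A \<union> ?B)" using assms
    by (intro edge_connected_Un[of _ _ "(0, 1)" "(1, 1)"] edge_connected_column edge_connected_rectangle)
      (auto simp: edge_adjacent_def)
  have "1 \<le> a * b" using assms by (simp add: Suc_le_eq)
  then show ?thesis
    by (intro realizable_hexagon[OF _ card conn, where a = "int a" and b = "int b" and v = 1
        and w = "int a" and e = "int b"]) (use assms in \<open>auto simp: of_nat_diff\<close>)
qed

text \<open>The hull is a 1-by-a rectangle and a trapezoid of width 1 with sides a and k, of area a
  + (a + k) / 2 in total. The excess has the parity of the number of cells.\<close>

lemma realizable_two_rows:
  assumes "1 \<le> k" "k \<le> a"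
  shows "realizable (a + k) (a - k)"
proof -
  let ?A = "{0 :: int} \<times> {0..int a - 1}" and ?B = "{1 :: int} \<times> {0..int k - 1}"
  have card: "card (?A \<union> ?B) = a + k" using assms by (subst card_Un_disjoint) auto
  have conn: "edge_connected (?A \<union> ?B)" using assms
    by (intro edge_connected_Un[of _ _ "(0, 0)" "(1, 0)"] edge_connected_column)
      (auto simp: edge_adjacent_def)
  show ?thesis
    by (intro realizable_hexagon[OF _ card conn, where a = "int a" and b = 2 and v = 0
        and w = "int k" and e = 1]) (use assms in \<open>auto simp: of_nat_diff\<close>)
qed

text \<open>For the other parity the top cell of the second column is raised by one, which lifts a
  corner of the hull from height k to k + 1 and gains 1/2. The raised cell hangs on the long column,
  hence k < a.\<close>

lemma realizable_two_rows_gap: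
  assumes "2 \<le> k" "k < a"
  shows "realizable (a + k) (a - k + 1)"
proof -
  let ?A = "{0 :: int} \<times> {0..int a - 1}" and ?B = "{1 :: int} \<times> {0..int k - 2}" and ?C = "{(1 :: int, int k)}"
  have card: "card (?A \<union> ?B \<union> ?C) = a + k" using assms
    by (subst card_Un_disjoint, simp, simp, force, subst card_Un_disjoint) auto
  have AB: "edge_connected (?A \<union> ?B)" using assms
    by (intro edge_connected_Un[of _ _ "(0, 0)" "(1, 0)"] edge_connected_column)
      (auto simp: edge_adjacent_def)
  have conn: "edge_connected (?A \<union> ?B \<union> ?C)" using assms
    by (intro edge_connected_Un[OF AB, of _ "(0, int k)" "(1, int k)"] edge_connected_singleton)
      (auto simp: edge_adjacent_def)
  show ?thesis
    by (intro realizable_hexagon[OF _ card conn, where a = "int a" and b = 2 and v = 0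
        and w = "int k + 1" and e = 1]) (use assms in \<open>auto simp: of_nat_diff\<close>)
qed

text \<open>A hook whose first arm (of length \<open>a\<close>) shifts from line \<open>0\<close> to line \<open>1\<close> at position \<open>v\<close>.\<close>

definition bent_hook :: "int \<Rightarrow> int \<Rightarrow> int \<Rightarrow> cell set" where
  "bent_hook a b v = {0} \<times> {v..a - 1} \<union> {1} \<times> {0..v} \<union> {2..b - 1} \<times> {0}"

lemma bent_hook:
  assumes "0 \<le> v" "v < a" "2 \<le> b"
  shows "finite (bent_hook a b v)" "int (card (bent_hook a b v)) = a + b - 1"
    "edge_connected (bent_hook a b v)"
proof -
  let ?A = "{0 :: int} \<times> {v..a - 1}" and ?B = "{1 :: int} \<times> {0..v}" and ?C = "{2..b - 1} \<times> {0 :: int}"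
  show "finite (bent_hook a b v)" by (simp add: bent_hook_def)
  have "card (?A \<union> ?B \<union> ?C) = card ?A + card ?B + card ?C"
    by (subst card_Un_disjoint, simp, simp, force, subst card_Un_disjoint) auto
  then show "int (card (bent_hook a b v)) = a + b - 1"
    using assms by (simp add: bent_hook_def card_cartesian_product)
  have AB: "edge_connected (?A \<union> ?B)" using assms
    by (intro edge_connected_Un[of _ _ "(0, v)" "(1, v)"] edge_connected_column)
      (auto simp: edge_adjacent_def)
  show "edge_connected (bent_hook a b v)"
  proof (cases "b = 2")
    case True
    then show ?thesis using AB by (simp add: bent_hook_def)
  next
    case False
    have "edge_connected ?C" using edge_connected_rectangle[of 2 "b - 1" 0 0] by simp
    then show ?thesis unfolding bent_hook_def using assms False
      by (intro edge_connected_Un[OF AB, of _ "(1, 0)" "(2, 0)"]) (auto simp: edge_adjacent_def)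
  qed
qed

text \<open>The rectangle loses a triangle with legs X and Y: (X + 1) (Y + 1) - X Y / 2 = X + Y + 1
  + X Y / 2.\<close>

lemma realizable_hook:
  assumes "1 \<le> X" "1 \<le> Y"
  shows "realizable (X + Y + 1) (X * Y)"
proof -
  note h = bent_hook[of 0 "int X + 1" "int Y + 1"]
  have "int X * i \<le> int X * int Y" if "i \<le> int Y" for i using that by (intro mult_left_mono) auto
  then show ?thesis using assms h
    by (intro realizable_hexagon[of "bent_hook (int X + 1) (int Y + 1) 0",
          where a = "int X + 1" and b = "int Y + 1" and v = 0 and w = 1 and e = 1])
      (auto simp: bent_hook_def algebra_simps)
qed

text \<open>Bending at position 1 cuts off a corner triangle of area 1/2. The cell (1, 1) of the
  bend stays under the slanted side if and only if (X - 1) (Y - 1) \<ge> 1, whence X, Y \<ge>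
  2.\<close>

lemma realizable_bent_hook:
  assumes "2 \<le> X" "2 \<le> Y"
  shows "realizable (X + Y + 1) (X * Y - 1)"
proof -
  note h = bent_hook[of 1 "int X + 1" "int Y + 1"]
  have slant: "(j + 1 - (int X + 1)) * (int Y + 1 - 1) \<le> (1 - (int X + 1)) * (i + 1 - 1)"
    if "(i, j) \<in> bent_hook (int X + 1) (int Y + 1) 1" for i j
  proof -
    from that assms consider "i = 0" "j \<le> int X" | "i = 1" "j \<le> 1" | "j = 0" "i \<le> int Y"
      by (auto simp: bent_hook_def)
    then show ?thesis
    proof cases
      case 1
      then show ?thesis using mult_nonpos_nonneg[of "j - int X" "int Y"] by simp
    next
      case 2
      have "(j - int X) * int Y \<le> (1 - int X) * int Y" using 2 by (intro mult_right_mono) auto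
      moreover have "1 \<le> (int X - 1) * (int Y - 1)"
        using assms mult_mono[of 1 "int X - 1" 1 "int Y - 1"] by simp
      ultimately show ?thesis using 2 by (simp add: algebra_simps)
    next
      case 3
      then have "int X * i \<le> int X * int Y" by (intro mult_left_mono) auto
      then show ?thesis using 3 by simp
    qed
  qed
  have card: "card (bent_hook (int X + 1) (int Y + 1) 1) = X + Y + 1" using h assms by simp
  have conn: "edge_connected (bent_hook (int X + 1) (int Y + 1) 1)" using h assms by simp
  have "1 \<le> X * Y" using assms by (simp add: Suc_le_eq)
  then have "int (X * Y - 1) = int X * int Y - 1" by (simp add: of_nat_diff)
  then have area: "2 * (int X + 1) * (int Y + 1) - 1 - (int Y + 1 - 1) * (int X + 1 - 1) =
      2 * int (X + Y + 1) + int (X * Y - 1)"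
    by (simp add: algebra_simps)
  show ?thesis
    by (rule realizable_hexagon[OF _ card conn _ _ _ _ _ _ _ _ _ _ _ _ _ area])
      (use assms h slant in \<open>auto simp: bent_hook_def\<close>)
qed

text \<open>The base gives up its last cell, which moves next to the top of the first arm. The hull
  then has a flat top of length 2, under which the bend may sit at any position v < X. The move
  costs 2 and the bend another v.\<close>

lemma realizable_double_hook:
  assumes "2 \<le> Y" "v < X"
  shows "realizable (X + Y + 1) (X * Y - 2 - v)"
proof -
  note h = bent_hook[of "int v" "int X + 1" "int Y"]
  let ?P = "bent_hook (int X + 1) (int Y) (int v) \<union> {(1, int X)}"
  have "card ?P = Suc (card (bent_hook (int X + 1) (int Y) (int v)))"
    using assms h by (subst card_Un_disjoint) (auto simp: bent_hook_def)
  then have card: "card ?P = X + Y + 1" using h assms by simp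
  have conn: "edge_connected ?P" using assms h
    by (intro edge_connected_Un[of _ _ "(0, int X)" "(1, int X)"] edge_connected_singleton)
      (auto simp: edge_adjacent_def bent_hook_def)
  have slant: "(j + 1 - (int X + 1)) * (int Y - 2) \<le> (1 - (int X + 1)) * (i + 1 - 2)"
    if "(i, j) \<in> ?P" for i j
  proof -
    from that assms consider "i \<le> 1" "j \<le> int X" | "j = 0" "i \<le> int Y - 1"
      by (auto simp: bent_hook_def)
    then show ?thesis
    proof cases
      case 1
      have "(j - int X) * (int Y - 2) \<le> 0" using 1 assms by (intro mult_nonpos_nonneg) auto
      moreover have "0 \<le> (- int X) * (i - 1)" using 1 by (intro mult_nonpos_nonpos) auto
      ultimately show ?thesis by simp
    next
      case 2
      then have "int X * (i - 1) \<le> int X * (int Y - 2)" by (intro mult_left_mono) auto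
      then show ?thesis using 2 by simp
    qed
  qed
  have "2 + v \<le> X * Y" using assms mult_le_mono2[of 2 Y X] by linarith
  then have "int (X * Y - 2 - v) = int X * int Y - 2 - int v" by (simp add: of_nat_diff)
  then have area: "2 * (int X + 1) * int Y - int v - (int Y - 2) * (int X + 1 - 1) =
      2 * int (X + Y + 1) + int (X * Y - 2 - v)"
    by (simp add: algebra_simps)
  show ?thesis
    by (rule realizable_hexagon[OF _ card conn _ _ _ _ _ _ _ _ _ _ _ _ _ area])
      (use assms h slant in \<open>auto simp: bent_hook_def\<close>)
qed

section \<open>Covering every admissible excess\<close>

lemma realizable_small:
  assumes "2 \<le> m" "m + 2 \<le> n"
  shows "realizable n m"
proof (cases "even (n - m)")
  case True
  then obtain k where "n - m = 2 * k" by blast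
  then have "1 \<le> k" "n = (n - k) + k" "m = (n - k) - k" "k \<le> n - k" using assms by auto
  then show ?thesis using realizable_two_rows[of k "n - k"] by metis
next
  case False
  \<comment> \<open>Half of n - m rounded up; as n - m is odd and at least 2, it is at least 3, so k
    \<ge> 2.\<close>
  then obtain k where "n - m + 1 = 2 * k" by (metis even_plus_one_iff evenE)
  then have "2 \<le> k" "n = (n - k) + k" "m = (n - k) - k + 1" "k < n - k" using assms by auto
  then show ?thesis using realizable_two_rows_gap[of k "n - k"] by metis
qed

text \<open>Since (X + 1) (Y - 1) = X Y - (X + 1 - Y), the shortfall r of m from X Y is at most X -
  Y. Hook, bent hook and double hook cover r = 0, r = 1 and r = 2 + v.\<close>

lemma realizable_large:
  assumes "2 \<le> Y" "Y \<le> X" "m \<le> X * Y" "(X + 1) * (Y - 1) < m"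
  shows "realizable (X + Y + 1) m"
proof -
  define r where "r = X * Y - m"
  have m: "m = X * Y - r" "r \<le> X * Y" using assms by (auto simp: r_def)
  have "(X + 1) * (Y - 1) = X * Y + Y - 1 - X" using assms by (cases Y) (auto simp: algebra_simps)
  then have "r \<le> X" using assms unfolding r_def by linarith
  consider "r = 0" | "r = 1" | v where "r = 2 + v" by (metis One_nat_def add_2_eq_Suc not0_implies_Suc)
  then show ?thesis
  proof cases
    case 3
    then have "m = X * Y - 2 - v" "v < X" using m \<open>r \<le> X\<close> by auto
    then show ?thesis using realizable_double_hook assms by simp
  qed (use realizable_hook realizable_bent_hook assms m in auto)
qed

lemma realizable_all:
  assumes "1 \<le> n" "m \<le> ((n - 1) div 2) * (n div 2)" "m = 1 \<Longrightarrow> \<not> prime (n + 1)"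
  shows "realizable n m"
proof -
  consider "m = 0" | "m = 1" | "2 \<le> m" "m + 2 \<le> n" | "2 \<le> m" "n < m + 2" by linarith
  then show ?thesis
  proof cases
    case 1
    then show ?thesis using realizable_line assms by simp
  next
    case 2
    then obtain a where a: "a dvd n + 1" "a \<noteq> 1" "a \<noteq> n + 1"
      using assms prime_nat_iff[of "n + 1"] by auto
    then obtain b where ab: "n + 1 = a * b" by (elim dvdE)
    have "a \<noteq> 0" "b \<noteq> 0" "b \<noteq> 1" using ab a by (metis add_is_0 mult_is_0 mult_1_right one_neq_zero)+
    then have "2 \<le> a" "2 \<le> b" using a by linarith+
    then have "realizable (a * b - 1) 1" by (rule realizable_rectangle_minus_corner)
    moreover have "n = a * b - 1" using ab by linarith
    ultimately show ?thesis using 2 by simp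
  next
    case 3
    then show ?thesis by (rule realizable_small)
  next
    case 4
    define p where "p Y \<longleftrightarrow> m \<le> (n - 1 - Y) * Y" for Y
    have "n - 1 - (n - 1) div 2 = n div 2" by linarith
    then have p0: "p ((n - 1) div 2)" using assms(2) by (simp add: p_def mult.commute)
    \<comment> \<open>By minimality the preceding pair (X + 1, Y - 1) no longer reaches m, which is
      the strict bound that \<open>realizable_large\<close> needs.\<close>
    define Y where "Y = (LEAST Y. p Y)"
    have Y: "p Y" "Y \<le> (n - 1) div 2" using p0 unfolding Y_def by (auto intro: LeastI Least_le)
    define X where "X = n - 1 - Y"
    have n: "n = X + Y + 1" and "Y \<le> X" using Y assms(1) by (auto simp: X_def)
    \<comment> \<open>At Y = 1 the product is n - 2, which is less than m here; this is why the
      smaller excesses are split off.\<close>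
    have "\<not> p 0" "\<not> p 1" using 4 by (auto simp: p_def)
    then have "2 \<le> Y" using Y by (cases Y; cases "Y - 1") (auto simp: numeral_2_eq_2)
    have "\<not> p (Y - 1)" using \<open>2 \<le> Y\<close> not_less_Least[of "Y - 1" p] by (simp add: Y_def)
    then have "(X + 1) * (Y - 1) < m" using n \<open>2 \<le> Y\<close> by (auto simp: p_def)
    moreover have "m \<le> X * Y" using Y by (simp add: p_def X_def)
    ultimately show ?thesis using realizable_large[OF \<open>2 \<le> Y\<close> \<open>Y \<le> X\<close>] n by simp
  qed
qed

lemma floor_half_product:
  assumes "1 \<le> n"
  shows "\<lfloor>(real n - 1) / 2\<rfloor> * \<lfloor>real n / 2\<rfloor> = int (((n - 1) div 2) * (n div 2))"
proof -
  have "(real n - 1) / 2 = real (n - 1) / real 2" using assms by (simp add: of_nat_diff)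
  then have "\<lfloor>(real n - 1) / 2\<rfloor> = int ((n - 1) div 2)" by (simp only: floor_divide_of_nat_eq of_nat_id)
  moreover have "\<lfloor>real n / 2\<rfloor> = int (n div 2)" using floor_divide_of_nat_eq[of n 2] by simp
  ultimately show ?thesis by (simp only: of_nat_mult)
qed

theorem theorem2:
  fixes n :: nat and m \<alpha> :: real
  assumes "n \<ge> 1" and "\<alpha> = real n + m / 2"
  shows "(\<exists>P. polyomino n P \<and> measure lebesgue (polyomino_hull P) = \<alpha>) \<longleftrightarrow>
    m \<in> \<nat> \<and> 0 \<le> m \<and> m \<le> of_int (\<lfloor>(real n - 1) / 2\<rfloor> * \<lfloor>real n / 2\<rfloor>) \<and>
    (prime (n + 1) \<longrightarrow> m \<noteq> 1)"
proof
  assume "\<exists>P. polyomino n P \<and> measure lebesgue (polyomino_hull P) = \<alpha>"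
  then obtain P where P: "polyomino n P" and area: "measure lebesgue (polyomino_hull P) = real n + m / 2"
    using assms(2) by blast
  have m: "m = 2 * measure lebesgue (polyomino_hull P) - 2 * real n" using area by simp
  have "finite P" using P by (simp add: polyomino_def)
  then have "m \<in> \<int>" unfolding m using polyomino_area_half_integral by (intro Ints_diff) auto
  moreover have "0 \<le> m" using polyomino_area_lower[OF P] area by simp
  moreover have "m \<le> of_int (\<lfloor>(real n - 1) / 2\<rfloor> * \<lfloor>real n / 2\<rfloor>)"
    unfolding floor_half_product[OF assms(1)] using polyomino_area_upper[OF P assms(1)] area by simp
  moreover have "prime (n + 1) \<longrightarrow> m \<noteq> 1"
    using area_half_excess_composite[OF P assms(1)] area by auto
  ultimately show "m \<in> \<nat> \<and> 0 \<le> m \<and> m \<le> of_int (\<lfloor>(real n - 1) / 2\<rfloor> * \<lfloor>real n / 2\<rfloor>) \<and>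
    (prime (n + 1) \<longrightarrow> m \<noteq> 1)" by (simp add: Nats_altdef2)
next
  assume rhs: "m \<in> \<nat> \<and> 0 \<le> m \<and> m \<le> of_int (\<lfloor>(real n - 1) / 2\<rfloor> * \<lfloor>real n / 2\<rfloor>) \<and>
    (prime (n + 1) \<longrightarrow> m \<noteq> 1)"
  then obtain k where k: "m = real k" by (auto elim: Nats_cases)
  have "real k \<le> real (((n - 1) div 2) * (n div 2))"
    using rhs unfolding floor_half_product[OF assms(1)] k by simp
  then have "k \<le> ((n - 1) div 2) * (n div 2)" by (simp only: of_nat_le_iff)
  moreover have "k = 1 \<Longrightarrow> \<not> prime (n + 1)" using rhs k by auto
  ultimately have "realizable n k" using realizable_all assms(1) by blast
  then show "\<exists>P. polyomino n P \<and> measure lebesgue (polyomino_hull P) = \<alpha>"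
    unfolding realizable_def assms(2) k .
qed

end
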